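(* Let $\mathcal{G}'$ be a directed graph with $n$ vertices and $m$ edges and incidence matrix $B\in\mathbb{R}^{n\times m}$, let $Q=\mathrm{diag}(q_1,\dots,q_n)$ with all $q_i>0$, let $r,d,\bar x_0,\bar x_s\in\mathbb{R}^n$ be constant vectors, let $\bar x(t)=\bar x_0+\bar x_s t$, and let $L_c$ be the Laplacian matrix of a connected communication graph on the same $n$ vertices. Let $u_e^+\in\mathbb{R}^m$ and $u_p^-,u_p^+\in\mathbb{R}^n$ satisfy the feasibility condition (defined in the context) for the given $d$, $r$ and $Q$. Suppose that 1. there exists at least one pair $q_i,q_j$ such that $q_i\neq q_j$; 2. the directed graph $\mathcal{G}'$ is strongly connected. Then for any given $\epsilon_1>0$ and $\epsilon_2>0$ there is a choice of gains $\gamma_e,\gamma_c,\gamma_p,\gamma_l>0$ such that every solution (for any initial condition) of the closed-loop system $$\dot x=Bu_e+u_p+d,\qquad y=x-\bar x,$$ $$\dot x_e=\gamma_e B^Ty,\qquad u_e=\mathrm{sat}\left(-\gamma_cB^Ty-\gamma_e x_e;\,0,\,u_e^+\right),$$ $$\dot x_p=-\gamma_l L_c\,\mathrm{sat}\left(x_p;\,\tfrac{1}{\gamma_p}(Qu_p^-+r),\,\tfrac{1}{\gamma_p}(Qu_p^++r)\right)-\gamma_pQ^{-1}\left(y-\gamma_cBu_e\right),$$ $$u_p=\mathrm{sat}\left(Q^{-1}(\gamma_p x_p-r);\,u_p^-,\,u_p^+\right)$$ satisfies $$\lim_{t\to\infty}\|x(t)-\bar x(t)\|<\epsilon_1,\qquad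 \lim_{t\to\infty}\|u_p(t)-\overline{u}_p\|<\epsilon_2,$$ and $$u_p^-\le u_p(t)\le u_p^+,\qquad 0\le u_e(t)\le u_e^+\qquad\text{for all }t\ge 0,$$ where $$\overline{u}_p=-Q^{-1}\left(\frac{\mathds{1}\mathds{1}^T}{\mathds{1}^TQ^{-1}\mathds{1}}\left(d-\bar x_s-Q^{-1}r\right)+r\right).$$
   Context: $\mathds{1}\in\mathbb{R}^n$ is the all-ones vector, $\|\cdot\|$ is a norm on $\mathbb{R}^n$, and vector inequalities are element-wise. The incidence matrix $B=(b_{ik})$ has $b_{ik}=1$ if node $i$ is the positive ($+$) end of edge $k$, $-1$ if node $i$ is the negative ($-$) end of edge $k$, and $0$ otherwise; each edge of $\mathcal{G}'$ is directed from its $-$ end to its $+$ end (the permitted flow direction). The Laplacian of a graph with incidence matrix $B$ is $BB^T$; thus $L_c=B_cB_c^T$ with $B_c$ the incidence matrix of the communication graph. The saturation function is defined component-wise: $\mathrm{sat}(x;x^-,x^+)_i=x_i^-$ if $x_i\le x_i^-$, $=x_i$ if $x_i^-<x_i<x_i^+$, and $=x_i^+$ if $x_i\ge x_i^+$. Here $x(t),x_p(t),u_p(t),y(t)\in\mathbb{R}^n$ and $x_e(t),u_e(t)\in\mathbb{R}^m$. Feasibility condition: $u_e^+,u_p^-,u_p^+$ satisfy the feasibility condition if $$u_p^-<\overline{u}_p<u_p^+$$ with $\overline{u}_p$ the vector displayed in the claim, and there exists $\overline{u}_e\in\mathbb{R}^m$ with $$B\overline{u}_e=-\left(I-\frac{Q^{-1}\mathds{1}\mathds{1}^T}{\mathds{1}^TQ^{-1}\mathds{1}}\right)\left(d-\bar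 x_s-Q^{-1}r\right),\qquad 0<\overline{u}_e<u_e^+.$$ (Equivalently $\overline{u}_e=-\gamma_e\bar x_e$, where $\bar x_e$ is a solution of $\gamma_eB\bar x_e=\left(I-\frac{Q^{-1}\mathds{1}\mathds{1}^T}{\mathds{1}^TQ^{-1}\mathds{1}}\right)(d-\bar x_s-Q^{-1}r)$; the condition does not depend on the gains.) *)

theory Defs
  imports "HOL-Analysis.Analysis" "Graph_Theory.Digraph_Component"
begin

definition is_norm :: "('a::real_vector \<Rightarrow> real) \<Rightarrow> bool" where
  "is_norm N \<longleftrightarrow>
     (\<forall>v. N v = 0 \<longleftrightarrow> v = 0) \<and>
     (\<forall>a v. N (a *\<^sub>R v) = \<bar>a\<bar> * N v) \<and>
     (\<forall>v w. N (v + w) \<le> N v + N w)"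

text \<open>
  Graphs are multigraphs without loops whose nodes and edges are exactly the elements of the
  finite types that index vectors in node space and edge space. The negative end of an
  edge is its tail and the positive end is its head. An undirected graph is represented by giving
  each of its edges an arbitrary orientation, exactly as is required to write down an incidence
  matrix; connectedness and the Laplacian do not depend on that choice.
\<close>

definition indexed_graph :: "('n::finite, 'm::finite) pre_digraph \<Rightarrow> bool" where
  "indexed_graph G \<longleftrightarrow> loopfree_digraph G \<and> verts G = UNIV \<and> arcs G = UNIV"

definition incidence :: "('n::finite, 'm::finite) pre_digraph \<Rightarrow> real ^ 'm ^ 'n" where
  "incidence G =
     (\<chi> i k. if i = head G k then 1 else if i = tail G k then - 1 else 0)"

definition laplacian :: "('n::finite, 'm::finite) pre_digraph \<Rightarrow> real ^ 'n ^ 'n" where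
  "laplacian G = incidence G ** transpose (incidence G)"

definition diag :: "real ^ 'n \<Rightarrow> real ^ 'n ^ 'n" where
  "diag q = (\<chi> i j. if i = j then q $ i else 0)"

definition sat :: "real ^ 'k \<Rightarrow> real ^ 'k \<Rightarrow> real ^ 'k \<Rightarrow> real ^ 'k" where
  "sat v lo hi =
     (\<chi> i. if v $ i \<le> lo $ i then lo $ i else if v $ i < hi $ i then v $ i else hi $ i)"

text \<open>
  The library order \<open><\<close> on vectors is not strict in every component, hence a separate
  relation.
\<close>

definition vec_less :: "real ^ 'k \<Rightarrow> real ^ 'k \<Rightarrow> bool" where
  "vec_less v w \<longleftrightarrow> (\<forall>i. v $ i < w $ i)"

text \<open>\<open>ones_matrix\<close> is the outer product of the all-ones vector \<open>1\<close> with itself.\<close>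

definition ones_matrix :: "real ^ 'n ^ 'n" where
  "ones_matrix = (\<chi> i j. 1)"

definition u_p_bar ::
  "real ^ 'n ^ 'n \<Rightarrow> real ^ 'n \<Rightarrow> real ^ 'n \<Rightarrow> real ^ 'n \<Rightarrow> real ^ 'n" where
  "u_p_bar Q r d xs =
     - (matrix_inv Q *v
          (((1 / (1 \<bullet> (matrix_inv Q *v 1))) *\<^sub>R ones_matrix) *v (d - xs - matrix_inv Q *v r) + r))"

definition feasible ::
  "real ^ 'm ^ 'n \<Rightarrow> real ^ 'n ^ 'n \<Rightarrow> real ^ 'n \<Rightarrow> real ^ 'n \<Rightarrow> real ^ 'n \<Rightarrow>
   real ^ 'm \<Rightarrow> real ^ 'n \<Rightarrow> real ^ 'n \<Rightarrow> bool" where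
  "feasible B Q r d xs ue_max up_min up_max \<longleftrightarrow>
     vec_less up_min (u_p_bar Q r d xs) \<and>
     vec_less (u_p_bar Q r d xs) up_max \<and>
     (\<exists>ue_bar.
        B *v ue_bar =
          - ((mat 1 - (1 / (1 \<bullet> (matrix_inv Q *v 1))) *\<^sub>R (matrix_inv Q ** ones_matrix)) *v
               (d - xs - matrix_inv Q *v r)) \<and>
        vec_less 0 ue_bar \<and> vec_less ue_bar ue_max)"

text \<open>
  Solutions are classical and defined on \<open>[0, \<infinity>)\<close>, with a one-sided derivative at \<open>0\<close>.
  The right-hand side is globally Lipschitz in the state and continuous in time, so for every
  initial state exactly one such solution exists and every local solution extends to it.
\<close>

definition closed_loop ::
  "real ^ 'm ^ 'n \<Rightarrow> real ^ 'n ^ 'n \<Rightarrow> real ^ 'n ^ 'n \<Rightarrow> real ^ 'n \<Rightarrow> real ^ 'n \<Rightarrow> (real \<Rightarrow> real ^ 'n) \<Rightarrow>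
   real ^ 'm \<Rightarrow> real ^ 'n \<Rightarrow> real ^ 'n \<Rightarrow>
   real \<Rightarrow> real \<Rightarrow> real \<Rightarrow> real \<Rightarrow>
   (real \<Rightarrow> real ^ 'n) \<Rightarrow> (real \<Rightarrow> real ^ 'm) \<Rightarrow> (real \<Rightarrow> real ^ 'n) \<Rightarrow>
   (real \<Rightarrow> real ^ 'n) \<Rightarrow> (real \<Rightarrow> real ^ 'm) \<Rightarrow> (real \<Rightarrow> real ^ 'n) \<Rightarrow> bool" where
  "closed_loop B Lc Q r d xbar ue_max up_min up_max \<gamma>e \<gamma>c \<gamma>p \<gamma>l x xe xp y ue up \<longleftrightarrow>
     (\<forall>t\<ge>0.
        (x has_vector_derivative (B *v ue t + up t + d)) (at t within {0..}) \<and>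
        y t = x t - xbar t \<and>
        (xe has_vector_derivative (\<gamma>e *\<^sub>R (transpose B *v y t))) (at t within {0..}) \<and>
        ue t = sat (- (\<gamma>c *\<^sub>R (transpose B *v y t)) - \<gamma>e *\<^sub>R xe t) 0 ue_max \<and>
        (xp has_vector_derivative
           (- (\<gamma>l *\<^sub>R (Lc *v sat (xp t) ((1 / \<gamma>p) *\<^sub>R (Q *v up_min + r))
                                     ((1 / \<gamma>p) *\<^sub>R (Q *v up_max + r))))
            - \<gamma>p *\<^sub>R (matrix_inv Q *v (y t - \<gamma>c *\<^sub>R (B *v ue t))))) (at t within {0..}) \<and>
        up t = sat (matrix_inv Q *v (\<gamma>p *\<^sub>R xp t - r)) up_min up_max)"

end

theory Submission
  imports Defs
begin

text \<open>
  Fix \<open>\<gamma>e = \<gamma>p = 1\<close> and write \<open>g\<^sub>i = 1 / q\<^sub>i\<close>. The theorem has a static and a dynamic part.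

  The static part asks for an equilibrium near the ideal operating point. The controller state of
  an equilibrium is a consensus value plus an offset \<open>v\<close>, and the output error is \<open>\<gamma>c c\<close> at every
  node. The pair \<open>(v, c)\<close> solves a linear system that contains the gains only through the ratio
  \<open>\<kappa> = \<gamma>l / \<gamma>c\<close>. Testing the system with \<open>v\<close> and using connectedness of the communication graph shows
  that \<open>v\<close> tends to zero as \<open>\<kappa>\<close> grows (lemma \<open>small_equilibrium_offset\<close>). A large \<open>\<kappa>\<close> therefore puts
  the node inputs within \<open>\<epsilon>2\<close> of the ideal ones and, by the strict feasibility margins, keeps
  both inputs of the equilibrium strictly inside their limits; the edge flow exists because the incidence
  matrix of the connected graph \<open>G\<close> reaches every vector with entries of sum zero. With \<open>\<kappa>\<close> and hence
  \<open>c\<close> fixed, a small \<open>\<gamma>c\<close> makes the output error smaller than \<open>\<epsilon>1\<close>.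

  The dynamic part shows that output error and node inputs converge to this equilibrium from every
  initial state. The equal unit gains make the interconnection passive: the energy of the output
  error plus convex potentials of the two saturations is a Lyapunov function \<open>V\<close> of which the
  derivative is minus a weighted sum of two squares, those of the disagreement of the saturated
  controller states and of the net edge flow error (\<open>V_deriv\<close>). By Barbalat's lemma both vanish. What is left is a family of oscillators
  with frequencies \<open>g\<^sub>i\<close> of which the saturated positions move in unison. Two different frequencies
  rule out any such motion except rest, provided that no node is saturated; a permanently saturated
  motion is impossible because the output error would grow without bound. Lemma
  \<open>errors_vanish\<close> makes this precise with a version of Barbalat's lemma for a union of time windows
  (\<open>barbalat_on_windows\<close>), which replaces the compactness argument of LaSalle's invariance principle.
\<close>

section \<open>Diagonal matrices, incidence matrices and connectedness\<close>

lemma matrix_inv_diag: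
  fixes q :: "real ^ 'n"
  assumes "\<forall>i. q $ i > 0"
  shows "matrix_inv (diag q) = diag (\<chi> i. 1 / q $ i)"
proof -
  have nz: "q $ i \<noteq> 0" for i using assms by (metis less_irrefl)
  have *: "diag q ** diag (\<chi> i. 1 / q $ i) = mat 1" "diag (\<chi> i. 1 / q $ i) ** diag q = mat 1"
    using nz by (auto simp: diag_def matrix_matrix_mult_def mat_def vec_eq_iff if_distrib
        [of "\<lambda>x. x * _"] cong: if_cong)
  have "diag q ** matrix_inv (diag q) = mat 1"
    unfolding matrix_inv_def by (rule someI2[where a = "diag (\<chi> i. 1 / q $ i)"]) (use * in auto)
  then have "diag (\<chi> i. 1 / q $ i) ** diag q ** matrix_inv (diag q) = diag (\<chi> i. 1 / q $ i)"
    by (simp add: matrix_mul_assoc[symmetric])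
  then show ?thesis
    using *(2) by simp
qed

lemma diag_mult_nth [simp]:
  fixes g v :: "real ^ 'n"
  shows "(diag g *v v) $ i = g $ i * v $ i"
  by (simp add: diag_def matrix_vector_mult_def if_distrib [of "\<lambda>x. x * _"] cong: if_cong)

lemma diag_self_adjoint:
  fixes g v w :: "real ^ 'n"
  shows "(diag g *v v) \<bullet> w = v \<bullet> (diag g *v w)"
  by (simp add: inner_vec_def algebra_simps)

lemma transpose_incidence_nth:
  assumes "indexed_graph G"
  shows "(transpose (incidence G) *v v) $ k = v $ head G k - v $ tail G k"
proof -
  interpret loopfree_digraph G using assms by (simp add: indexed_graph_def)
  have ne: "tail G k \<noteq> head G k"
    using assms no_loops by (simp add: indexed_graph_def)
  have "(transpose (incidence G) *v v) $ k
      = (\<Sum>i\<in>UNIV. (if i = head G k then v $ i else 0) + (if i = tail G k then - v $ i else 0))"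
    unfolding incidence_def transpose_def matrix_vector_mult_def
    using ne by (simp, intro sum.cong) auto
  also have "\<dots> = v $ head G k - v $ tail G k"
    by (simp add: sum.distrib)
  finally show ?thesis .
qed

text \<open>
  Connectedness enters only through this rule. An equivalence relation that relates the ends of
  every edge relates all nodes. With equality of entries it identifies the kernel of
  \<open>transpose (incidence G)\<close>; with ``the difference of two signals tends to zero'' it turns
  vanishing disagreement along edges into consensus.
\<close>

lemma connected_equivp_induct:
  fixes G :: "('n::finite, 'm::finite) pre_digraph"
  assumes "indexed_graph G" "Digraph_Component.connected G"
    and "equivp R" "\<And>e. R (tail G e) (head G e)"
  shows "R u v"
proof -
  have "(u, v) \<in> rtrancl_on (verts G) (arcs_ends (mk_symmetric G))"
    using assms(1,2) by (auto simp: indexed_graph_def connected_def strongly_connected_def reachable_def)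
  then show ?thesis
  proof (induction rule: rtrancl_on_induct)
    case base
    show ?case using \<open>equivp R\<close> by (simp add: equivp_reflp)
  next
    case (step x z)
    have "R x z"
      using step(2) assms(3,4)
      by (auto simp: parcs_mk_symmetric dest: equivp_symp)
    then show ?case using step assms(3) equivp_transp by metis
  qed
qed

lemma strongly_connected_imp_connected:
  assumes "indexed_graph G" "strongly_connected G"
  shows "Digraph_Component.connected G"
proof -
  interpret loopfree_digraph G using assms by (simp add: indexed_graph_def)
  show ?thesis using assms(2) reachable_mk_symmetricI
    unfolding connected_def strongly_connected_def by simp
qed

lemma transpose_incidence_kernel:
  assumes "indexed_graph G" "Digraph_Component.connected G"
    and "transpose (incidence G) *v v = 0"
  shows "v $ i = v $ j"
proof -
  have "equivp (\<lambda>i j. v $ i = v $ j)"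
    by (intro equivpI reflpI sympI transpI) auto
  then show ?thesis
    by (rule connected_equivp_induct[OF assms(1,2)])
      (use assms(3) transpose_incidence_nth[OF assms(1), of v] in \<open>simp add: vec_eq_iff\<close>)
qed

lemma transpose_incidence_const:
  assumes "indexed_graph G"
  shows "transpose (incidence G) *v (c *\<^sub>R 1) = 0"
  using transpose_incidence_nth[OF assms, of "c *\<^sub>R 1"] by (simp add: vec_eq_iff)

lemma matrix_adjoint:
  fixes A :: "real ^ 'm ^ 'n"
  shows "w \<bullet> (transpose A *v v) = (A *v w) \<bullet> v"
  by (metis dot_lmul_matrix vector_transpose_matrix inner_commute)

lemma inner_laplacian:
  "v \<bullet> (laplacian G *v w) = (transpose (incidence G) *v v) \<bullet> (transpose (incidence G) *v w)"
  unfolding laplacian_def matrix_vector_mul_assoc[symmetric]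
  by (metis matrix_adjoint inner_commute)

text \<open>
  The range of a matrix is the orthogonal complement of the kernel of its transpose, and for a
  connected graph this kernel consists of the constant vectors.
\<close>

lemma range_incidence:
  assumes "indexed_graph G" "Digraph_Component.connected G" and "1 \<bullet> v = 0"
  shows "v \<in> range ((*v) (incidence G))"
proof -
  let ?S = "range ((*v) (incidence G))"
  have sub: "subspace ?S"
    by (simp add: linear_subspace_image)
  have "v \<in> ?S\<^sup>\<bottom>\<^sup>\<bottom>"
    unfolding orthogonal_comp_def orthogonal_def mem_Collect_eq
  proof
    fix x assume "x \<in> {x. \<forall>y\<in>?S. y \<bullet> x = 0}"
    then have "w \<bullet> (transpose (incidence G) *v x) = 0" for w
      using matrix_adjoint[of w "incidence G" x] by auto
    then have "transpose (incidence G) *v x = 0"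
      by (metis inner_eq_zero_iff)
    then have "x $ i = x $ undefined" for i
      using transpose_incidence_kernel[OF assms(1,2)] by blast
    then have "x = (x $ undefined) *\<^sub>R 1"
      by (simp add: vec_eq_iff)
    then show "x \<bullet> v = 0"
      using assms(3) by (metis inner_scaleR_left mult_zero_right)
  qed
  then show ?thesis using orthogonal_comp_self[OF sub] by simp
qed

section \<open>Saturation and its potential\<close>

text \<open>
  The scalar saturation, written as a projection onto \<open>{lo..hi}\<close>. It agrees with \<open>sat\<close> in every
  component in which the two limits are ordered.
\<close>

definition clip :: "real \<Rightarrow> real \<Rightarrow> real \<Rightarrow> real" where
  "clip lo hi z = max lo (min hi z)"

text \<open>
  The convex function \<open>(z\<^sup>2 - dist(z, {lo..hi})\<^sup>2) / 2\<close>, whose derivative is the saturation.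
\<close>

definition sat_potential :: "real \<Rightarrow> real \<Rightarrow> real \<Rightarrow> real" where
  "sat_potential lo hi z = clip lo hi z * z - (clip lo hi z)\<^sup>2 / 2"

lemma sat_nth:
  assumes "lo $ i \<le> hi $ i"
  shows "sat v lo hi $ i = clip (lo $ i) (hi $ i) (v $ i)"
  using assms by (auto simp: sat_def clip_def)

lemma clip_bounds:
  assumes "lo \<le> hi"
  shows "lo \<le> clip lo hi z" "clip lo hi z \<le> hi"
  using assms by (auto simp: clip_def)

lemma clip_lipschitz: "\<bar>clip lo hi z - clip lo hi w\<bar> \<le> \<bar>z - w\<bar>"
  by (auto simp: clip_def max_def min_def)

lemma clip_unsaturated: "lo < clip lo hi z \<Longrightarrow> clip lo hi z < hi \<Longrightarrow> clip lo hi z = z"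
  by (auto simp: clip_def max_def min_def split: if_splits)

lemma clip_id: "lo \<le> z \<Longrightarrow> z \<le> hi \<Longrightarrow> clip lo hi z = z"
  by (auto simp: clip_def)

text \<open>
  The variational inequality that characterises the projection onto an interval.
\<close>

lemma clip_projection:
  assumes "lo \<le> hi" "lo \<le> c" "c \<le> hi"
  shows "(z - clip lo hi z) * (clip lo hi z - c) \<ge> 0"
  using assms by (auto simp: clip_def max_def min_def mult_nonneg_nonneg mult_nonpos_nonpos)

text \<open>
  The graph of a convex function lies above its tangents. The gap is a product controlled by the
  variational inequality plus half a square.
\<close>

lemma sat_potential_tangent:
  assumes "lo \<le> hi"
  shows "sat_potential lo hi z + clip lo hi z * (w - z) \<le> sat_potential lo hi w"
proof -
  have "0 \<le> (w - clip lo hi w) * (clip lo hi w - clip lo hi z) + (clip lo hi w - clip lo hi z)\<^sup>2 / 2"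
    using clip_projection[of lo hi "clip lo hi z" w] clip_bounds[OF assms, of z] assms
    by simp
  also have "\<dots> = sat_potential lo hi w - sat_potential lo hi z - clip lo hi z * (w - z)"
    by (simp add: sat_potential_def field_simps power2_eq_square)
  finally show ?thesis by simp
qed

text \<open>
  The tangents at \<open>z\<close> and at \<open>w\<close> enclose the error of the linear approximation between \<open>0\<close> and
  \<open>(clip w - clip z) (w - z) \<le> (w - z)\<^sup>2\<close>, which treats all pieces of the saturation at once.
\<close>

lemma has_derivative_sat_potential:
  assumes "lo \<le> hi"
  shows "(sat_potential lo hi has_real_derivative clip lo hi z) (at z)"
  unfolding has_field_derivative_iff
proof (rule Lim_null [THEN iffD2], rule tendsto_0_le[where K = 1])
  show "((\<lambda>w. w - z) \<longlongrightarrow> 0) (at z)"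
    by (intro tendsto_eq_intros) auto
  have "norm ((sat_potential lo hi w - sat_potential lo hi z) / (w - z) - clip lo hi z) \<le> norm (w - z) * 1"
    if "w \<noteq> z" for w
  proof -
    have a: "clip lo hi z * (w - z) \<le> sat_potential lo hi w - sat_potential lo hi z"
      and b: "sat_potential lo hi w - sat_potential lo hi z \<le> clip lo hi w * (w - z)"
      using sat_potential_tangent[OF assms, of z w] sat_potential_tangent[OF assms, of w z]
      by (auto simp: algebra_simps)
    have c: "\<bar>clip lo hi w - clip lo hi z\<bar> \<le> \<bar>w - z\<bar>" by (rule clip_lipschitz)
    define D where "D = sat_potential lo hi w - sat_potential lo hi z - clip lo hi z * (w - z)"
    have "0 \<le> D" "D \<le> (clip lo hi w - clip lo hi z) * (w - z)"
      using a b by (auto simp: D_def algebra_simps)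
    moreover have "(clip lo hi w - clip lo hi z) * (w - z) \<le> \<bar>w - z\<bar> * \<bar>w - z\<bar>"
      using mult_right_mono[OF c, of "\<bar>w - z\<bar>"]
      by (metis abs_ge_self abs_ge_zero abs_mult order_trans)
    ultimately have "\<bar>D\<bar> \<le> \<bar>w - z\<bar> * \<bar>w - z\<bar>" by simp
    moreover have "(sat_potential lo hi w - sat_potential lo hi z) / (w - z) - clip lo hi z = D / (w - z)"
      using that by (simp add: D_def field_simps)
    ultimately show ?thesis
      using that by (simp add: abs_divide divide_le_eq)
  qed
  then show "\<forall>\<^sub>F w in at z. norm ((sat_potential lo hi w - sat_potential lo hi z) / (w - z) - clip lo hi z)
      \<le> norm (w - z) * 1"
    by (auto simp: eventually_at_filter)
qed

section \<open>Barbalat's lemma on windows\<close>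

lemma mvt_half_line:
  fixes f :: "real \<Rightarrow> real"
  assumes "\<And>t. t \<ge> 0 \<Longrightarrow> (f has_real_derivative f' t) (at t within {0..})"
    and "0 \<le> a" "a \<le> b"
  obtains \<xi> where "a \<le> \<xi>" "\<xi> \<le> b" "f b - f a = f' \<xi> * (b - a)"
proof -
  have "(f has_derivative (*) (f' x)) (at x within {a..b})" if "a \<le> x" "x \<le> b" for x
    using assms(1)[of x] that assms(2) unfolding has_field_derivative_def
    by (auto intro: has_derivative_subset)
  then show ?thesis
    using mvt_very_simple[of a b f "\<lambda>x. (*) (f' x)"] assms(3) that by auto
qed

text \<open>
  Barbalat's lemma says that a convergent function with uniformly continuous derivative has a
  vanishing derivative. The proof is local: the mean value theorem on a short interval around \<open>t\<close>
  gives a point with small derivative, and uniform continuity carries this to \<open>t\<close>. It therefore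
  survives when time is restricted to a set \<open>U\<close> in which every point lies in an interval of a fixed
  length contained in \<open>U\<close>. This version applies to signals of which the behaviour is known only
  during recurring periods.
\<close>

lemma barbalat_on_windows:
  fixes f f' :: "real \<Rightarrow> real"
  assumes deriv: "\<And>t. t \<ge> 0 \<Longrightarrow> (f has_real_derivative f' t) (at t within {0..})"
    and uc: "uniformly_continuous_on {0..} f'"
    and "\<tau> > 0"
    and windows: "\<And>t. t \<in> U \<Longrightarrow> \<exists>a\<ge>0. t \<in> {a..a+\<tau>} \<and> {a..a+\<tau>} \<subseteq> U"
    and lim: "(f \<longlongrightarrow> l) (inf at_top (principal U))"
  shows "(f' \<longlongrightarrow> 0) (inf at_top (principal U))"
proof (rule tendstoI)
  fix \<epsilon> :: real assume "\<epsilon> > 0"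
  obtain \<delta> where "\<delta> > 0" and \<delta>: "\<And>u v. u \<ge> 0 \<Longrightarrow> v \<ge> 0 \<Longrightarrow> dist u v < \<delta> \<Longrightarrow> dist (f' u) (f' v) < \<epsilon>/2"
    using uc \<open>\<epsilon> > 0\<close> unfolding uniformly_continuous_on_def
    by (metis atLeast_iff half_gt_zero)
  define h where "h = min \<tau> (\<delta>/2)"
  have h: "h > 0" "h \<le> \<tau>" "h < \<delta>" using \<open>\<tau> > 0\<close> \<open>\<delta> > 0\<close> by (auto simp: h_def)
  have "\<forall>\<^sub>F t in inf at_top (principal U). dist (f t) l < \<epsilon> * h / 4"
    by (rule tendstoD[OF lim]) (use \<open>\<epsilon> > 0\<close> h in auto)
  then obtain T where T: "\<And>t. t \<ge> T \<Longrightarrow> t \<in> U \<Longrightarrow> dist (f t) l < \<epsilon> * h / 4"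
    by (auto simp: eventually_inf_principal eventually_at_top_linorder)
  have "dist (f' t) 0 < \<epsilon>" if "t \<ge> T + \<tau>" "t \<in> U" for t
  proof -
    obtain a where a: "a \<ge> 0" "t \<in> {a..a+\<tau>}" "{a..a+\<tau>} \<subseteq> U" using windows[OF \<open>t \<in> U\<close>] by blast
    \<comment> \<open>a subwindow of length \<open>h\<close> that still contains \<open>t\<close>\<close>
    define c where "c = min t (a + \<tau> - h)"
    have c: "c \<ge> a" "c + h \<le> a + \<tau>" "c \<le> t" "t \<le> c + h" "c \<ge> T"
      using a h that by (auto simp: c_def)
    obtain \<xi> where \<xi>: "c \<le> \<xi>" "\<xi> \<le> c + h" "f (c+h) - f c = f' \<xi> * h"
      using mvt_half_line[OF deriv, of c "c+h"] a c h by auto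
    have "dist (f c) l < \<epsilon> * h / 4" "dist (f (c+h)) l < \<epsilon> * h / 4"
      using T c a h by (auto simp: subset_iff)
    then have "\<bar>f (c+h) - f c\<bar> < \<epsilon> * h / 4 + \<epsilon> * h / 4"
      unfolding dist_real_def by arith
    moreover have "\<bar>f (c+h) - f c\<bar> = \<bar>f' \<xi>\<bar> * h"
      using \<xi>(3) h by (simp add: abs_mult)
    ultimately have "\<bar>f' \<xi>\<bar> * h < \<epsilon>/2 * h" by simp
    then have "\<bar>f' \<xi>\<bar> < \<epsilon>/2" using h by simp
    moreover have "dist (f' t) (f' \<xi>) < \<epsilon>/2"
      using \<delta>[of t \<xi>] \<xi>(1,2) c a h by (auto simp: dist_real_def)
    ultimately show ?thesis unfolding dist_real_def by arith
  qed
  then show "\<forall>\<^sub>F t in inf at_top (principal U). dist (f' t) 0 < \<epsilon>"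
    by (auto simp: eventually_inf_principal eventually_at_top_linorder)
qed

text \<open>
  A bounded derivative on the convex half line gives a Lipschitz bound.
\<close>

lemma uniformly_continuous_of_bounded_derivative:
  fixes f :: "real \<Rightarrow> 'a::real_normed_vector"
  assumes "\<And>t. t \<ge> 0 \<Longrightarrow> (f has_vector_derivative f' t) (at t within {0..})"
    and "bounded (f' ` {0..})"
  shows "uniformly_continuous_on {0..} f"
proof -
  obtain C where C: "C > 0" "\<And>t. t \<ge> 0 \<Longrightarrow> norm (f' t) \<le> C"
    using assms(2) by (auto simp: bounded_pos)
  have "C-lipschitz_on {0..} f"
  proof (rule bounded_derivative_imp_lipschitz)
    show "(f has_derivative (\<lambda>h. h *\<^sub>R f' x)) (at x within {0..})" if "x \<in> {0..}" for x
      using assms(1)[of x] that by (simp add: has_vector_derivative_def)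
    show "onorm (\<lambda>h. h *\<^sub>R f' x) \<le> C" if "x \<in> {0..}" for x
      using mult_left_mono[OF C(2)[of x]] that by (intro onorm_le) (auto simp: mult.commute[of C])
  qed (use C in auto)
  then show ?thesis by (rule lipschitz_on_uniformly_continuous)
qed

section \<open>Real signals on the half line\<close>

lemma bounded_image_linear:
  assumes "bounded_linear h" "bounded (f ` S)"
  shows "bounded ((\<lambda>t. h (f t)) ` S)"
  using bounded_linear_image[OF assms(2,1)] by (simp add: image_image)

lemma bounded_image_uminus:
  fixes f :: "'a \<Rightarrow> 'b::real_normed_vector"
  shows "bounded (f ` S) \<Longrightarrow> bounded ((\<lambda>t. - f t) ` S)"
  by (rule bounded_image_linear[OF bounded_linear_minus[OF bounded_linear_ident]])

lemma uniformly_continuous_norm_sq: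
  fixes f :: "'a::metric_space \<Rightarrow> 'b::euclidean_space"
  assumes "uniformly_continuous_on S f" "bounded (f ` S)"
  shows "uniformly_continuous_on S (\<lambda>t. (norm (f t))\<^sup>2)"
proof (rule uniformly_continuous_on_compose[OF assms(1)])
  have "uniformly_continuous_on (closure (f ` S)) (\<lambda>x. (norm x)\<^sup>2)"
    using assms(2) by (intro compact_uniformly_continuous continuous_intros) auto
  then show "uniformly_continuous_on (f ` S) (\<lambda>x. (norm x)\<^sup>2)"
    unfolding uniformly_continuous_on_def using closure_subset[of "f ` S"]
    by (meson subsetD)
qed

lemma uniformly_continuous_vec_nth:
  fixes f :: "real \<Rightarrow> real ^ 'n"
  shows "uniformly_continuous_on S f \<Longrightarrow> uniformly_continuous_on S (\<lambda>t. f t $ i)"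
  by (rule bounded_linear.uniformly_continuous_on[OF bounded_linear_vec_nth])

text \<open>
  Otherwise the derivative would stay above \<open>c\<close> after time \<open>T\<close>, and the function would grow without
  bound.
\<close>

lemma bounded_imp_derivative_small:
  fixes f :: "real \<Rightarrow> real"
  assumes deriv: "\<And>t. t \<ge> 0 \<Longrightarrow> (f has_real_derivative f' t) (at t within {0..})"
    and "bounded (f ` {0..})" and "c > 0" and "T \<ge> 0"
  obtains t where "t \<ge> T" "f' t < c"
proof -
  obtain M where M: "\<And>t. t \<ge> 0 \<Longrightarrow> \<bar>f t\<bar> \<le> M"
    using assms(2) by (auto simp: bounded_iff)
  define h where "h = (2 * M + 1) / c"
  have "M \<ge> 0" using M[of 0] by simp
  then have h: "h > 0" "c * h = 2 * M + 1" using \<open>c > 0\<close> by (auto simp: h_def)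
  obtain \<xi> where \<xi>: "T \<le> \<xi>" "f (T + h) - f T = f' \<xi> * h"
    using mvt_half_line[OF deriv, of T "T + h"] \<open>T \<ge> 0\<close> h by auto
  have "f (T + h) - f T < c * h"
    using M[of T] M[of "T + h"] h \<open>T \<ge> 0\<close> by auto
  then have "f' \<xi> * h < c * h" using \<xi>(2) by simp
  then have "f' \<xi> < c" using h(1) by simp
  then show ?thesis using that \<xi> by blast
qed

lemma decreasing_bounded_below_converges:
  fixes V :: "real \<Rightarrow> real"
  assumes dec: "\<And>a b. 0 \<le> a \<Longrightarrow> a \<le> b \<Longrightarrow> V b \<le> V a" and low: "\<And>t. t \<ge> 0 \<Longrightarrow> m \<le> V t"
  shows "(V \<longlongrightarrow> Inf (V ` {0..})) at_top"
proof (rule decreasing_tendsto)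
  have bdd: "bdd_below (V ` {0..})" using low by (auto intro!: bdd_belowI[of _ m])
  show "\<forall>\<^sub>F t in at_top. Inf (V ` {0..}) \<le> V t"
    using eventually_ge_at_top[of 0] by eventually_elim (auto intro: cInf_lower bdd)
  fix x assume "Inf (V ` {0..}) < x"
  then obtain a where a: "a \<ge> 0" "V a < x"
    using cInf_lessD[of "V ` {0..}" x] by auto
  show "\<forall>\<^sub>F t in at_top. V t < x"
    using eventually_ge_at_top[of a] by eventually_elim (use a dec in force)
qed

section \<open>Convergence of the saturated error dynamics\<close>

text \<open>
  The closed loop in coordinates relative to an equilibrium, for the gains \<open>\<gamma>e = \<gamma>p = 1\<close>. The vector
  \<open>g\<close> holds the reciprocals of the \<open>q\<^sub>i\<close>; \<open>y\<close> is the output error, \<open>p\<close> the controller state with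
  saturation limits \<open>plo\<close>, \<open>phi\<close>, and \<open>z\<close> is the argument of the edge saturation with limits \<open>elo\<close>,
  \<open>ehi\<close>. The signals \<open>s\<close> and \<open>w\<close> are the deviations of the two saturated quantities from their
  equilibrium values \<open>pc\<close> and \<open>ec\<close>.
\<close>

locale saturated_error_system =
  fixes B :: "real ^ 'm ^ 'n" and C :: "('n::finite, 'c::finite) pre_digraph"
    and g :: "real ^ 'n" and \<gamma>c \<gamma>l :: real
    and plo phi pc :: "real ^ 'n" and elo ehi ec :: "real ^ 'm"
    and y p s :: "real \<Rightarrow> real ^ 'n" and z w :: "real \<Rightarrow> real ^ 'm"
  assumes graph: "indexed_graph C" "Digraph_Component.connected C"
    and g_pos: "\<And>i. g $ i > 0"
    and gains_pos: "\<gamma>c > 0" "\<gamma>l > 0"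
    and pc_interior: "\<And>i. plo $ i < pc $ i" "\<And>i. pc $ i < phi $ i"
    and ec_admissible: "\<And>k. elo $ k \<le> ec $ k" "\<And>k. ec $ k \<le> ehi $ k"
    and s_eq: "\<And>t i. s t $ i = clip (plo $ i) (phi $ i) (p t $ i) - pc $ i"
    and w_eq: "\<And>t k. w t $ k = clip (elo $ k) (ehi $ k) (z t $ k) - ec $ k"
    and y_deriv: "\<And>t. t \<ge> 0 \<Longrightarrow>
      (y has_vector_derivative (B *v w t + diag g *v s t)) (at t within {0..})"
    and p_deriv: "\<And>t. t \<ge> 0 \<Longrightarrow>
      (p has_vector_derivative (- (\<gamma>l *\<^sub>R (laplacian C *v s t)) - diag g *v (y t - \<gamma>c *\<^sub>R (B *v w t))))
        (at t within {0..})"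
    and z_deriv: "\<And>t. t \<ge> 0 \<Longrightarrow>
      (z has_vector_derivative (- (\<gamma>c *\<^sub>R (transpose B *v (B *v w t + diag g *v s t))) - transpose B *v y t))
        (at t within {0..})"
begin

abbreviation y' where "y' t \<equiv> B *v w t + diag g *v s t"
abbreviation p' where "p' t \<equiv> - (\<gamma>l *\<^sub>R (laplacian C *v s t)) - diag g *v (y t - \<gamma>c *\<^sub>R (B *v w t))"
abbreviation z' where "z' t \<equiv> - (\<gamma>c *\<^sub>R (transpose B *v y' t)) - transpose B *v y t"
abbreviation disagreement where "disagreement t \<equiv> transpose (incidence C) *v s t"

text \<open>
  The Lyapunov function: kinetic energy plus the convex potentials of the two saturations, tilted so
  that they are minimal at the equilibrium.
\<close>

definition V where
  "V t = (y t \<bullet> y t) / 2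
     + (\<Sum>i\<in>UNIV. sat_potential (plo $ i) (phi $ i) (p t $ i) - pc $ i * p t $ i)
     + (\<Sum>k\<in>UNIV. sat_potential (elo $ k) (ehi $ k) (z t $ k) - ec $ k * z t $ k)"

abbreviation V' where "V' t \<equiv> - \<gamma>l * (norm (disagreement t))\<^sup>2 - \<gamma>c * (norm (B *v w t))\<^sup>2"

lemma bounds_ordered: "plo $ i \<le> phi $ i" "elo $ k \<le> ehi $ k"
  using pc_interior[of i] ec_admissible[of k] by auto

lemma nth_deriv:
  assumes "t \<ge> 0"
  shows "((\<lambda>t. y t $ i) has_real_derivative y' t $ i) (at t within {0..})"
    and "((\<lambda>t. p t $ i) has_real_derivative p' t $ i) (at t within {0..})"
    and "((\<lambda>t. z t $ k) has_real_derivative z' t $ k) (at t within {0..})"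
  unfolding has_real_derivative_iff_has_vector_derivative
  by (rule bounded_linear.has_vector_derivative[OF bounded_linear_vec_nth] y_deriv p_deriv z_deriv assms)+

text \<open>
  The coupling terms cancel. The terms \<open>y \<bullet> B w\<close> and \<open>y \<bullet> diag g s\<close> of the energy are matched by
  the gradient of the potentials because the matrix that feeds an input into \<open>y\<close> is the transpose
  of the one that feeds \<open>y\<close> back. The terms that pair \<open>B w\<close> with \<open>diag g s\<close> cancel because the
  controller of \<open>p\<close> compensates the damping \<open>\<gamma>c B w\<close> of the edges. Only the two dissipation terms
  remain.
\<close>

lemma V_deriv:
  assumes "t \<ge> 0"
  shows "(V has_real_derivative V' t) (at t within {0..})"
proof -
  have quad: "((\<lambda>t. (y t \<bullet> y t) / 2) has_real_derivative y t \<bullet> y' t) (at t within {0..})"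
    using bounded_bilinear.has_vector_derivative[OF bounded_bilinear_inner y_deriv[OF assms] y_deriv[OF assms]]
    unfolding has_real_derivative_iff_has_vector_derivative[symmetric]
    by (auto intro: DERIV_cdivide[THEN DERIV_cong] simp: inner_commute)
  have pot: "((\<lambda>t. sat_potential a b (u t) - c * u t) has_real_derivative (clip a b (u t) - c) * u') (at t within {0..})"
    if "(u has_real_derivative u') (at t within {0..})" "a \<le> b" for a b c u' and u :: "real \<Rightarrow> real"
    using that
    by (auto intro!: derivative_eq_intros DERIV_chain2[OF has_derivative_sat_potential] simp: algebra_simps)
  have "(V has_real_derivative y t \<bullet> y' t + (\<Sum>i\<in>UNIV. s t $ i * p' t $ i) + (\<Sum>k\<in>UNIV. w t $ k * z' t $ k))
      (at t within {0..})"
    unfolding V_def[abs_def] s_eq w_eq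
    by (intro DERIV_add quad DERIV_sum pot nth_deriv[unfolded s_eq w_eq] assms bounds_ordered)
  also have "y t \<bullet> y' t + (\<Sum>i\<in>UNIV. s t $ i * p' t $ i) + (\<Sum>k\<in>UNIV. w t $ k * z' t $ k)
      = y t \<bullet> y' t + s t \<bullet> p' t + w t \<bullet> z' t"
    by (simp add: inner_vec_def)
  also have "\<dots> = V' t"
  proof -
    have "s t \<bullet> (laplacian C *v s t) = (norm (disagreement t))\<^sup>2"
      by (simp add: inner_laplacian power2_norm_eq_inner)
    then show ?thesis
      unfolding inner_diff_right inner_add_right inner_minus_right inner_scaleR_right matrix_adjoint
        diag_self_adjoint[of g "s t" "y t - \<gamma>c *\<^sub>R (B *v w t)", symmetric] power2_norm_eq_inner
      by (simp add: inner_commute[of _ "y t"] inner_commute[of "diag g *v s t" "B *v w t"] distrib_left)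
  qed
  finally show ?thesis .
qed

lemma V_nonincreasing:
  assumes "0 \<le> a" "a \<le> b"
  shows "V b \<le> V a"
proof -
  obtain \<xi> where "a \<le> \<xi>" "V b - V a = V' \<xi> * (b - a)"
    using mvt_half_line[OF V_deriv assms] by metis
  moreover have "V' \<xi> \<le> 0"
  proof -
    have "0 \<le> \<gamma>l * (norm (disagreement \<xi>))\<^sup>2" "0 \<le> \<gamma>c * (norm (B *v w \<xi>))\<^sup>2"
      using gains_pos by simp_all
    then show ?thesis by arith
  qed
  ultimately show ?thesis using assms by (metis diff_ge_0_iff_ge diff_le_0_iff_le mult_nonpos_nonneg)
qed

text \<open>
  Each tilted potential is bounded below by its value at the equilibrium: there the slope of the
  tangent is zero.
\<close>

lemma y_norm_le_V:
  obtains m where "\<And>t. (y t \<bullet> y t) / 2 + m \<le> V t"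
proof -
  have le: "plo $ i \<le> pc $ i" "pc $ i \<le> phi $ i" for i
    using pc_interior less_imp_le by blast+
  have pot: "sat_potential lo hi c - c * c \<le> sat_potential lo hi u - c * u" if "lo \<le> c" "c \<le> hi" for lo hi c u
    using sat_potential_tangent[of lo hi c u] that by (simp add: clip_id algebra_simps)
  have "(y t \<bullet> y t) / 2 + ((\<Sum>i\<in>UNIV. sat_potential (plo $ i) (phi $ i) (pc $ i) - pc $ i * pc $ i)
     + (\<Sum>k\<in>UNIV. sat_potential (elo $ k) (ehi $ k) (ec $ k) - ec $ k * ec $ k)) \<le> V t" for t
    unfolding V_def add.assoc
    by (intro add_mono sum_mono order_refl) (simp_all add: pot le ec_admissible)
  then show ?thesis using that by blast
qed

lemma V_converges: obtains l where "(V \<longlongrightarrow> l) at_top"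
proof -
  obtain m where "\<And>t. (y t \<bullet> y t) / 2 + m \<le> V t" using y_norm_le_V by blast
  then have m: "(y t \<bullet> y t) / 2 + m \<le> V t" for t .
  have "m \<le> V t" for t using m[of t] inner_ge_zero[of "y t"] by linarith
  then show ?thesis using decreasing_bounded_below_converges[of V m] V_nonincreasing that by blast
qed

lemma bounded_y: "bounded (y ` {0..})"
proof -
  obtain m where m: "\<And>t. (y t \<bullet> y t) / 2 + m \<le> V t" using y_norm_le_V by blast
  have "norm (y t) \<le> sqrt (2 * (V 0 - m))" if "t \<ge> 0" for t
    unfolding norm_eq_sqrt_inner using m[of t] V_nonincreasing[of 0 t] that
    by (intro real_sqrt_le_mono) simp
  then show ?thesis by (auto simp: bounded_iff)
qed

text \<open>
  The derivatives of \<open>y\<close>, \<open>p\<close> and \<open>z\<close> contain \<open>p\<close> and \<open>z\<close> only through their saturations. As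
  \<open>y\<close> is bounded, so are these derivatives, without any bound on \<open>p\<close> and \<open>z\<close>. Hence all signals are
  uniformly continuous.
\<close>

lemma bounded_s: "bounded (s ` {0..})"
proof -
  have "norm (s t) \<le> (\<Sum>i\<in>UNIV. phi $ i - plo $ i)" for t
  proof -
    have "\<bar>s t $ i\<bar> \<le> phi $ i - plo $ i" for i
      using clip_bounds[OF bounds_ordered(1), of i "p t $ i"] pc_interior[of i] by (auto simp: s_eq)
    then show ?thesis
      by (intro order_trans[OF norm_le_l1_cart] sum_mono)
  qed
  then show ?thesis by (auto simp: bounded_iff)
qed

lemma bounded_w: "bounded (w ` {0..})"
proof -
  have "norm (w t) \<le> (\<Sum>i\<in>UNIV. ehi $ i - elo $ i)" for t
  proof -
    have "\<bar>w t $ i\<bar> \<le> ehi $ i - elo $ i" for i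
      using clip_bounds[OF bounds_ordered(2), of i "z t $ i"] ec_admissible[of i] by (auto simp: w_eq)
    then show ?thesis
      by (intro order_trans[OF norm_le_l1_cart] sum_mono)
  qed
  then show ?thesis by (auto simp: bounded_iff)
qed

lemma bounded_Bw: "bounded ((\<lambda>t. B *v w t) ` {0..})"
  by (intro bounded_image_linear[OF _ bounded_w] matrix_vector_mul_bounded_linear)

lemma bounded_y': "bounded (y' ` {0..})"
  by (intro bounded_plus_comp bounded_Bw bounded_image_linear[OF _ bounded_s] matrix_vector_mul_bounded_linear)

lemma bounded_p': "bounded (p' ` {0..})"
  by (intro bounded_minus_comp bounded_image_uminus bounded_scaleR_comp bounded_Bw bounded_y
      bounded_image_linear[OF matrix_vector_mul_bounded_linear] bounded_s)

lemma bounded_z': "bounded (z' ` {0..})"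
  by (intro bounded_minus_comp bounded_image_uminus bounded_scaleR_comp bounded_y bounded_y'
      bounded_image_linear[OF matrix_vector_mul_bounded_linear])

lemma uniformly_continuous_clip:
  fixes u :: "real \<Rightarrow> real ^ 'k" and v :: "real \<Rightarrow> real ^ 'k"
  assumes "uniformly_continuous_on S u" and "\<And>t i. v t $ i = clip (lo $ i) (hi $ i) (u t $ i) - c $ i"
  shows "uniformly_continuous_on S v"
proof -
  have "dist (v t) (v r) \<le> dist (u t) (u r)" for t r
    unfolding dist_norm
    by (rule norm_le_componentwise_cart) (simp add: assms(2) clip_lipschitz)
  then show ?thesis
    using assms(1) unfolding uniformly_continuous_on_def by (meson le_less_trans)
qed

lemma uniformly_continuous_y: "uniformly_continuous_on {0..} y"
  using uniformly_continuous_of_bounded_derivative[OF y_deriv bounded_y'] .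

lemma uniformly_continuous_s: "uniformly_continuous_on {0..} s"
  using uniformly_continuous_clip[OF uniformly_continuous_of_bounded_derivative[OF p_deriv bounded_p'] s_eq] .

lemma uniformly_continuous_w: "uniformly_continuous_on {0..} w"
  using uniformly_continuous_clip[OF uniformly_continuous_of_bounded_derivative[OF z_deriv bounded_z'] w_eq] .

lemma uniformly_continuous_matrix_mult: "uniformly_continuous_on {0..} (u :: real \<Rightarrow> real ^ 'k) \<Longrightarrow> uniformly_continuous_on {0..} (\<lambda>t. A *v u t)"
  by (rule bounded_linear.uniformly_continuous_on[OF matrix_vector_mul_bounded_linear])

lemma uniformly_continuous_y': "uniformly_continuous_on {0..} y'"
  by (intro continuous_intros uniformly_continuous_matrix_mult uniformly_continuous_w uniformly_continuous_s)

lemma uniformly_continuous_p': "uniformly_continuous_on {0..} p'"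
  by (intro continuous_intros uniformly_continuous_matrix_mult uniformly_continuous_w uniformly_continuous_s uniformly_continuous_y)

text \<open>
  \<open>V\<close> decreases to a limit, and its derivative is uniformly continuous.
\<close>

lemma V'_vanishes: "(V' \<longlongrightarrow> 0) at_top"
proof -
  obtain l where l: "(V \<longlongrightarrow> l) at_top" using V_converges by blast
  have uc: "uniformly_continuous_on {0..} V'"
    by (intro continuous_intros uniformly_continuous_norm_sq uniformly_continuous_matrix_mult uniformly_continuous_w uniformly_continuous_s bounded_Bw
        bounded_image_linear[OF matrix_vector_mul_bounded_linear] bounded_s)
  have "(V' \<longlongrightarrow> 0) (inf at_top (principal {0..}))"
  proof (rule barbalat_on_windows[OF V_deriv uc, where \<tau> = 1])
    show "(V \<longlongrightarrow> l) (inf at_top (principal {0..}))"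
      using l by (rule tendsto_mono[OF inf_le1])
    show "\<exists>a\<ge>0. t \<in> {a..a+1} \<and> {a..a+1} \<subseteq> {0..}" if "t \<in> {0..}" for t :: real
      using that by (intro exI[of _ t]) auto
  qed auto
  moreover have "inf at_top (principal {0::real..}) = at_top"
    using eventually_ge_at_top[of "0::real"] by (simp add: inf_absorb1 le_principal)
  ultimately show ?thesis by simp
qed

lemma disagreement_vanishes: "(disagreement \<longlongrightarrow> 0) at_top"
proof -
  have "((\<lambda>t. (norm (disagreement t))\<^sup>2) \<longlongrightarrow> 0) at_top"
  proof (rule tendsto_0_le[OF V'_vanishes, where K = "1 / \<gamma>l"])
    have "(norm (disagreement t))\<^sup>2 \<le> \<bar>V' t\<bar> / \<gamma>l" for t
    proof -
      have "0 \<le> \<gamma>c * (norm (B *v w t))\<^sup>2" using gains_pos by simp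
      then have "\<gamma>l * (norm (disagreement t))\<^sup>2 \<le> \<bar>V' t\<bar>" by arith
      then show ?thesis using gains_pos by (simp add: pos_le_divide_eq mult.commute)
    qed
    then show "\<forall>\<^sub>F t in at_top. norm ((norm (disagreement t))\<^sup>2) \<le> norm (V' t) * (1 / \<gamma>l)"
      by simp
  qed
  then show ?thesis
    by (simp add: tendsto_norm_zero_iff)
qed

lemma Bw_vanishes: "((\<lambda>t. B *v w t) \<longlongrightarrow> 0) at_top"
proof -
  have "((\<lambda>t. (norm (B *v w t))\<^sup>2) \<longlongrightarrow> 0) at_top"
  proof (rule tendsto_0_le[OF V'_vanishes, where K = "1 / \<gamma>c"])
    have "(norm (B *v w t))\<^sup>2 \<le> \<bar>V' t\<bar> / \<gamma>c" for t
    proof -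
      have "0 \<le> \<gamma>l * (norm (disagreement t))\<^sup>2" using gains_pos by simp
      then have "\<gamma>c * (norm (B *v w t))\<^sup>2 \<le> \<bar>V' t\<bar>" by arith
      then show ?thesis using gains_pos by (simp add: pos_le_divide_eq mult.commute)
    qed
    then show "\<forall>\<^sub>F t in at_top. norm ((norm (B *v w t))\<^sup>2) \<le> norm (V' t) * (1 / \<gamma>c)"
      by simp
  qed
  then show ?thesis
    by (simp add: tendsto_norm_zero_iff)
qed

lemma Ls_vanishes: "((\<lambda>t. laplacian C *v s t) \<longlongrightarrow> 0) at_top"
proof -
  have "((\<lambda>t. incidence C *v disagreement t) \<longlongrightarrow> incidence C *v 0) at_top"
    by (rule bounded_linear.tendsto[OF matrix_vector_mul_bounded_linear disagreement_vanishes])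
  then show ?thesis
    unfolding laplacian_def matrix_vector_mul_assoc by (simp del: transpose_matrix_vector)
qed

lemma s_consensus: "((\<lambda>t. s t $ i - s t $ j) \<longlongrightarrow> 0) at_top"
proof (rule connected_equivp_induct[OF graph, of "\<lambda>i j. ((\<lambda>t. s t $ i - s t $ j) \<longlongrightarrow> 0) at_top"])
  show "equivp (\<lambda>i j. ((\<lambda>t. s t $ i - s t $ j) \<longlongrightarrow> 0) at_top)"
  proof (intro equivpI reflpI sympI transpI)
    fix i j k
    show "((\<lambda>t. s t $ i - s t $ i) \<longlongrightarrow> 0) at_top" by simp
    assume ij: "((\<lambda>t. s t $ i - s t $ j) \<longlongrightarrow> 0) at_top"
    show "((\<lambda>t. s t $ j - s t $ i) \<longlongrightarrow> 0) at_top"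
      using tendsto_minus[OF ij] by simp
    assume jk: "((\<lambda>t. s t $ j - s t $ k) \<longlongrightarrow> 0) at_top"
    show "((\<lambda>t. s t $ i - s t $ k) \<longlongrightarrow> 0) at_top"
      using tendsto_add[OF ij jk] by simp
  qed
  show "((\<lambda>t. s t $ tail C e - s t $ head C e) \<longlongrightarrow> 0) at_top" for e
    using tendsto_minus[OF tendsto_vec_nth[OF disagreement_vanishes, of e]]
    by (simp add: transpose_incidence_nth[OF graph(1)] del: transpose_matrix_vector)
qed

text \<open>
  As \<open>B w\<close> vanishes, \<open>y $ i\<close> is eventually driven by \<open>g $ i * s $ i\<close> alone. Boundedness of \<open>y\<close>
  therefore excludes that \<open>s $ i\<close> stays above \<open>\<eta>\<close> or stays below \<open>-\<eta>\<close>; by continuity it keeps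
  returning to the interval between these bounds.
\<close>

lemma recurs_to_small_s:
  assumes "\<eta> > 0" "T \<ge> 0"
  obtains t where "t \<ge> T" "\<bar>s t $ i\<bar> \<le> \<eta>"
proof -
  have "((\<lambda>t. (B *v w t) $ i) \<longlongrightarrow> 0) at_top"
    using tendsto_vec_nth[OF Bw_vanishes, of i] by simp
  then have "\<forall>\<^sub>F t in at_top. dist ((B *v w t) $ i) 0 < g $ i * \<eta> / 2"
    by (rule tendstoD) (use assms g_pos in simp)
  then obtain T1 where T1: "\<And>t. t \<ge> T1 \<Longrightarrow> \<bar>(B *v w t) $ i\<bar> < g $ i * \<eta> / 2"
    by (auto simp: eventually_at_top_linorder)
  define T2 where "T2 = max T T1"
  have pos: "g $ i * \<eta> / 2 > 0" "T2 \<ge> 0" using assms g_pos by (auto simp: T2_def)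
  have bdd: "bounded ((\<lambda>t. y t $ i) ` {0..})"
    by (rule bounded_image_linear[OF bounded_linear_vec_nth bounded_y])
  obtain t1 where t1: "t1 \<ge> T2" "y' t1 $ i < g $ i * \<eta> / 2"
    using bounded_imp_derivative_small[OF nth_deriv(1) bdd pos] by blast
  obtain t2 where t2: "t2 \<ge> T2" "- (y' t2 $ i) < g $ i * \<eta> / 2"
    using bounded_imp_derivative_small[OF DERIV_minus[OF nth_deriv(1)] bounded_image_uminus[OF bdd] pos] by blast
  have "g $ i * s t1 $ i < g $ i * \<eta>"
    using t1 T1[of t1] by (simp add: T2_def)
  then have 1: "s t1 $ i < \<eta>" using g_pos by simp
  have "g $ i * - s t2 $ i < g $ i * \<eta>"
    using t2 T1[of t2] by (simp add: T2_def)
  then have 2: "- s t2 $ i < \<eta>" using g_pos mult_less_cancel_left_pos by blast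
  have cont: "continuous_on A (\<lambda>t. s t $ i)" if "A \<subseteq> {0..}" for A
    using continuous_on_subset[OF uniformly_continuous_imp_continuous[OF uniformly_continuous_vec_nth[OF uniformly_continuous_s]] that] .
  have "\<exists>t\<ge>T2. \<bar>s t $ i\<bar> \<le> \<eta>"
  proof (cases "\<bar>s t1 $ i\<bar> \<le> \<eta> \<or> \<bar>s t2 $ i\<bar> \<le> \<eta>")
    case True
    then show ?thesis using t1 t2 by blast
  next
    case False
    then have sgn: "s t1 $ i \<le> 0" "0 \<le> s t2 $ i" using 1 2 by auto
    have "\<exists>t\<ge>T2. s t $ i = 0"
    proof (cases "t1 \<le> t2")
      case True
      then obtain t where "t \<ge> t1" "s t $ i = 0"
        using IVT'[of "\<lambda>t. s t $ i" t1 0 t2] sgn cont[of "{t1..t2}"] t1(1) pos(2) by auto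
      then show ?thesis using t1(1) by (intro exI[of _ t]) simp
    next
      case False
      then obtain t where "t \<ge> t2" "s t $ i = 0"
        using IVT2'[of "\<lambda>t. s t $ i" t1 0 t2] sgn cont[of "{t2..t1}"] t2(1) pos(2) by auto
      then show ?thesis using t2(1) by (intro exI[of _ t]) simp
    qed
    then show ?thesis using assms by force
  qed
  then show ?thesis using that by (auto simp: T2_def)
qed

text \<open>
  After removal of the vanishing terms, the error dynamics are \<open>p' = - diag g y\<close> and
  \<open>y' = diag g s\<close>: decoupled oscillators with frequencies \<open>g $ i\<close> as long as no node saturates.
\<close>

lemma p'_asymptotics:
  assumes "F \<le> at_top"
  shows "((\<lambda>t. p' t $ i + g $ i * y t $ i) \<longlongrightarrow> 0) F"
proof -
  have "((\<lambda>t. - (\<gamma>l * (laplacian C *v s t) $ i) + g $ i * (\<gamma>c * (B *v w t) $ i)) \<longlongrightarrow>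
      - (\<gamma>l * (0 :: real ^ 'n) $ i) + g $ i * (\<gamma>c * (0 :: real ^ 'n) $ i)) at_top"
    by (intro tendsto_intros tendsto_vec_nth Ls_vanishes Bw_vanishes)
  then show ?thesis
    by (intro tendsto_mono[OF assms]) (simp add: algebra_simps)
qed

lemma y'_asymptotics:
  assumes "F \<le> at_top"
  shows "((\<lambda>t. y' t $ i - g $ i * s t $ i) \<longlongrightarrow> 0) F"
  using tendsto_mono[OF assms tendsto_vec_nth[OF Bw_vanishes, of i]] by simp

text \<open>
  During a period of fixed length \<open>\<tau>\<close> after a late time with small \<open>s $ i\<close> no node is saturated, as
  \<open>s $ i\<close> moves slowly and all entries of \<open>s\<close> agree asymptotically. Let \<open>U\<close> be the union of these
  periods. On \<open>U\<close> the entries of \<open>p - pc\<close> agree asymptotically as well. Two applications of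
  Barbalat's lemma on \<open>U\<close> differentiate this twice and give \<open>(g $ j)\<^sup>2 s $ j - (g $ i)\<^sup>2 s $ i \<rightarrow> 0\<close>:
  oscillators with different frequencies cannot move in unison unless they are at rest. As
  \<open>g $ i \<noteq> g $ j\<close>, the common value of \<open>s\<close> vanishes on \<open>U\<close>, and a third application makes \<open>y\<close>
  vanish on \<open>U\<close>. In particular \<open>s $ i\<close> is again small at the end of every late period, so the next
  period starts at once and \<open>U\<close> contains all late times.
\<close>

theorem errors_vanish:
  assumes "g $ i \<noteq> g $ j"
  shows "(y \<longlongrightarrow> 0) at_top" "(s \<longlongrightarrow> 0) at_top"
proof -
  \<comment> \<open>the distance of the equilibrium to the saturation limits\<close>
  define \<beta> where "\<beta> = Min (range (\<lambda>k. min (phi $ k - pc $ k) (pc $ k - plo $ k)))"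
  have \<beta>: "\<beta> > 0" "\<beta> \<le> phi $ k - pc $ k" "\<beta> \<le> pc $ k - plo $ k" for k
  proof -
    show "\<beta> > 0" using pc_interior by (simp add: \<beta>_def)
    have "\<beta> \<le> min (phi $ k - pc $ k) (pc $ k - plo $ k)"
      unfolding \<beta>_def by (rule Min_le) auto
    then show "\<beta> \<le> phi $ k - pc $ k" "\<beta> \<le> pc $ k - plo $ k" by simp_all
  qed
  have unsaturated: "p t $ k = pc $ k + s t $ k" if "\<bar>s t $ k\<bar> < \<beta>" for t k
  proof -
    have "\<bar>clip (plo $ k) (phi $ k) (p t $ k) - pc $ k\<bar> < \<beta>" using that by (simp add: s_eq)
    then have "plo $ k < clip (plo $ k) (phi $ k) (p t $ k)" "clip (plo $ k) (phi $ k) (p t $ k) < phi $ k"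
      using \<beta>(2,3)[of k] by linarith+
    then have "clip (plo $ k) (phi $ k) (p t $ k) = p t $ k" by (rule clip_unsaturated)
    then show ?thesis using s_eq[of t k] by linarith
  qed
  obtain \<delta> where "\<delta> > 0" and \<delta>: "\<And>t r. t \<ge> 0 \<Longrightarrow> r \<ge> 0 \<Longrightarrow> dist t r < \<delta> \<Longrightarrow> dist (s t $ i) (s r $ i) < \<beta> / 4"
    using uniformly_continuous_vec_nth[OF uniformly_continuous_s, of i] \<beta>(1) unfolding uniformly_continuous_on_def
    by (metis atLeast_iff divide_pos_pos zero_less_numeral)
  define \<tau> where "\<tau> = \<delta> / 2"
  have \<tau>: "\<tau> > 0" "\<tau> < \<delta>" using \<open>\<delta> > 0\<close> by (auto simp: \<tau>_def)
  define A where "A = {t. t \<ge> 0 \<and> \<bar>s t $ i\<bar> \<le> \<beta> / 2}"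
  define U where "U = (\<Union>t\<in>A. {t..t + \<tau>})"
  define F where "F = inf at_top (principal U)"
  have F: "F \<le> at_top" by (simp add: F_def)
  have windows: "\<exists>a\<ge>0. t \<in> {a..a + \<tau>} \<and> {a..a + \<tau>} \<subseteq> U" if "t \<in> U" for t
    using that by (auto simp: U_def A_def)
  have barbalat: "(f' \<longlongrightarrow> 0) F"
    if "\<And>t. t \<ge> 0 \<Longrightarrow> (f has_real_derivative f' t) (at t within {0..})"
      "uniformly_continuous_on {0..} f'" "(f \<longlongrightarrow> l) F" for f f' :: "real \<Rightarrow> real" and l
    unfolding F_def
    by (rule barbalat_on_windows[OF _ that(2) \<tau>(1) _ that(3)[unfolded F_def]])
      (rule that(1) windows, assumption)+
  have on_U: "\<bar>s u $ i\<bar> < 3 / 4 * \<beta>" if u: "u \<in> U" for u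
  proof -
    obtain t where t: "t \<ge> 0" "\<bar>s t $ i\<bar> \<le> \<beta> / 2" "t \<le> u" "u \<le> t + \<tau>"
      using u by (auto simp: U_def A_def)
    have "dist (s u $ i) (s t $ i) < \<beta> / 4" using \<delta>[of u t] t \<tau> by (auto simp: dist_real_def)
    then show ?thesis using t(2) unfolding dist_real_def by arith
  qed
  have consensus: "((\<lambda>t. s t $ k - s t $ i) \<longlongrightarrow> 0) F" for k
    by (rule tendsto_mono[OF F s_consensus])
  have ev_unsat: "\<forall>\<^sub>F t in F. p t $ k = pc $ k + s t $ k" for k
  proof -
    have "\<forall>\<^sub>F t in F. dist (s t $ k - s t $ i) 0 < \<beta> / 4"
      by (rule tendstoD[OF consensus]) (use \<beta> in auto)
    moreover have "\<forall>\<^sub>F t in F. t \<in> U" by (simp add: F_def eventually_inf_principal)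
    ultimately show ?thesis
    proof eventually_elim
      case (elim t)
      then have "\<bar>s t $ k\<bar> < \<beta>" using on_U[of t] unfolding dist_real_def by arith
      then show ?case by (rule unsaturated)
    qed
  qed
  have p_diff: "((\<lambda>t. p t $ j - p t $ i) \<longlongrightarrow> pc $ j - pc $ i) F"
  proof -
    have "((\<lambda>t. (pc $ j - pc $ i) + (s t $ j - s t $ i)) \<longlongrightarrow> (pc $ j - pc $ i) + 0) F"
      by (intro tendsto_intros consensus)
    moreover have "\<forall>\<^sub>F t in F. (pc $ j - pc $ i) + (s t $ j - s t $ i) = p t $ j - p t $ i"
      using ev_unsat[of i] ev_unsat[of j] by eventually_elim simp
    ultimately show ?thesis by (simp add: tendsto_cong)
  qed
  have "((\<lambda>t. p' t $ j - p' t $ i) \<longlongrightarrow> 0) F"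
    by (rule barbalat[OF DERIV_diff[OF nth_deriv(2) nth_deriv(2)] uniformly_continuous_on_diff p_diff])
      (rule uniformly_continuous_vec_nth[OF uniformly_continuous_p'] | assumption)+
  then have y_diff: "((\<lambda>t. g $ j * y t $ j - g $ i * y t $ i) \<longlongrightarrow> 0) F"
    using tendsto_diff[OF tendsto_diff[OF p'_asymptotics[OF F, of j] p'_asymptotics[OF F, of i]]] by force
  have "((\<lambda>t. g $ j * y' t $ j - g $ i * y' t $ i) \<longlongrightarrow> 0) F"
    by (rule barbalat[OF DERIV_diff[OF DERIV_cmult[OF nth_deriv(1)] DERIV_cmult[OF nth_deriv(1)]]
          uniformly_continuous_on_diff y_diff])
      (rule uniformly_continuous_on_cmul_left[OF uniformly_continuous_vec_nth[OF uniformly_continuous_y']] | assumption)+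
  then have "((\<lambda>t. (g $ j * y' t $ j - g $ i * y' t $ i) - g $ j * (y' t $ j - g $ j * s t $ j)
      + g $ i * (y' t $ i - g $ i * s t $ i) - (g $ j)\<^sup>2 * (s t $ j - s t $ i)) \<longlongrightarrow>
      0 - g $ j * 0 + g $ i * 0 - (g $ j)\<^sup>2 * 0) F"
    by (intro tendsto_intros y'_asymptotics F consensus)
  moreover have "(g $ j * y' t $ j - g $ i * y' t $ i) - g $ j * (y' t $ j - g $ j * s t $ j)
      + g $ i * (y' t $ i - g $ i * s t $ i) - (g $ j)\<^sup>2 * (s t $ j - s t $ i)
      = ((g $ j)\<^sup>2 - (g $ i)\<^sup>2) * s t $ i" for t
    by (simp add: algebra_simps power2_eq_square)
  ultimately have "((\<lambda>t. ((g $ j)\<^sup>2 - (g $ i)\<^sup>2) * s t $ i) \<longlongrightarrow> 0) F"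
    by simp
  moreover have "(g $ j)\<^sup>2 - (g $ i)\<^sup>2 \<noteq> 0"
    using assms g_pos[of i] g_pos[of j] by (simp add: power2_eq_iff)
  ultimately have si: "((\<lambda>t. s t $ i) \<longlongrightarrow> 0) F"
    by (metis tendsto_mult_left_iff mult_zero_right)
  have s0: "((\<lambda>t. s t $ k) \<longlongrightarrow> 0) F" for k
    using tendsto_add[OF consensus[of k] si] by simp
  have p_lim: "((\<lambda>t. p t $ k) \<longlongrightarrow> pc $ k) F" for k
    using tendsto_add[OF tendsto_const s0, of "pc $ k" k] ev_unsat[of k]
    by (subst tendsto_cong) auto
  have "((\<lambda>t. p' t $ k) \<longlongrightarrow> 0) F" for k
    by (rule barbalat[OF nth_deriv(2) uniformly_continuous_vec_nth[OF uniformly_continuous_p'] p_lim])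
  then have "((\<lambda>t. g $ k * y t $ k) \<longlongrightarrow> 0) F" for k
    using tendsto_diff[OF p'_asymptotics[OF F, of k], of "\<lambda>t. p' t $ k" 0] by simp
  then have y0: "((\<lambda>t. y t $ k) \<longlongrightarrow> 0) F" for k
    using g_pos[of k] by (metis tendsto_mult_left_iff mult_zero_right less_irrefl)
  have "F = at_top"
  proof -
    have "\<forall>\<^sub>F t in F. dist (s t $ i) 0 < \<beta> / 2"
      by (rule tendstoD[OF si]) (use \<beta> in auto)
    then obtain T where T: "\<And>t. t \<ge> T \<Longrightarrow> t \<in> U \<Longrightarrow> \<bar>s t $ i\<bar> < \<beta> / 2"
      by (auto simp: F_def eventually_inf_principal eventually_at_top_linorder)
    obtain a where a: "a \<ge> max 0 T" "\<bar>s a $ i\<bar> \<le> \<beta> / 2"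
      using recurs_to_small_s[of "\<beta> / 2" "max 0 T"] \<beta>(1) by auto
    \<comment> \<open>consecutive windows starting at \<open>a\<close> chain up\<close>
    have inA: "a + real n * \<tau> \<in> A" for n
    proof (induction n)
      case 0
      then show ?case using a by (simp add: A_def)
    next
      case (Suc n)
      have "a + real (Suc n) * \<tau> \<in> U"
        unfolding U_def using \<tau>(1) by (intro UN_I[OF Suc]) (auto simp: algebra_simps)
      moreover have "0 \<le> real (Suc n) * \<tau>" using \<tau>(1) by simp
      ultimately show ?case using T[of "a + real (Suc n) * \<tau>"] a unfolding A_def by simp
    qed
    have "t \<in> U" if "t \<ge> a" for t
    proof -
      define n where "n = nat \<lfloor>(t - a) / \<tau>\<rfloor>"
      have "0 \<le> (t - a) / \<tau>" using that \<tau>(1) by simp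
      then have "real n \<le> (t - a) / \<tau>" "(t - a) / \<tau> \<le> real n + 1"
        unfolding n_def by linarith+
      then have "t \<in> {a + real n * \<tau>..a + real n * \<tau> + \<tau>}"
        using \<tau>(1) by (simp add: pos_le_divide_eq pos_divide_le_eq algebra_simps)
      then show ?thesis using inA[of n] unfolding U_def by blast
    qed
    then have "\<forall>\<^sub>F t in at_top. t \<in> U" by (auto simp: eventually_at_top_linorder)
    then show ?thesis by (simp add: F_def inf_absorb1 le_principal)
  qed
  then show "(y \<longlongrightarrow> 0) at_top" "(s \<longlongrightarrow> 0) at_top"
    using y0 s0 by (auto intro!: vec_tendstoI)
qed

end

section \<open>An equilibrium close to the ideal one\<close>

lemma is_norm_nonneg:
  assumes "is_norm N"
  shows "0 \<le> N v"
proof -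
  have "N (- 1 *\<^sub>R v) = N v" using assms unfolding is_norm_def by (metis abs_minus_cancel abs_one mult_1)
  moreover have "N (v + - 1 *\<^sub>R v) \<le> N v + N (- 1 *\<^sub>R v)" using assms unfolding is_norm_def by blast
  moreover have "N (v + - 1 *\<^sub>R v) = 0" using assms by (simp add: is_norm_def)
  ultimately show ?thesis by linarith
qed

text \<open>
  A norm on \<open>real ^ 'n\<close> is Lipschitz for the Euclidean norm, by expansion in the standard basis.
\<close>

lemma is_norm_tendsto:
  fixes N :: "real ^ 'n \<Rightarrow> real"
  assumes "is_norm N" and lim: "(f \<longlongrightarrow> a) F"
  shows "((\<lambda>t. N (f t)) \<longlongrightarrow> N a) F"
proof -
  have tri: "N (v + w) \<le> N v + N w" and scale: "N (c *\<^sub>R v) = \<bar>c\<bar> * N v" and zero: "N 0 = 0" for v w c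
    using assms(1) by (auto simp: is_norm_def)
  have minus: "N (- v) = N v" for v using scale[of "-1" v] by simp
  have nonneg: "0 \<le> N v" for v using is_norm_nonneg[OF assms(1)] .
  have bound: "N v \<le> (\<Sum>i\<in>UNIV. N (axis i 1)) * norm v" for v
  proof -
    have "N (\<Sum>i\<in>I. v $ i *\<^sub>R axis i 1) \<le> (\<Sum>i\<in>I. \<bar>v $ i\<bar> * N (axis i 1))" if "finite I" for I
      using that by (induction I rule: finite_induct) (auto simp: zero scale intro: order_trans[OF tri])
    from this[of UNIV] have "N v \<le> (\<Sum>i\<in>UNIV. \<bar>v $ i\<bar> * N (axis i 1))"
      using basis_expansion[of v] by (simp add: scalar_mult_eq_scaleR)
    also have "\<dots> \<le> (\<Sum>i\<in>UNIV. norm v * N (axis i 1))"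
      by (intro sum_mono mult_right_mono nonneg component_le_norm_cart)
    finally show ?thesis by (simp add: sum_distrib_left mult.commute)
  qed
  have lipschitz: "norm (N (f t) - N a) \<le> norm (f t - a) * (\<Sum>i\<in>UNIV. N (axis i 1))" for t
  proof -
    have "N (f t) \<le> N (f t - a) + N a" using tri[of "f t - a" a] by simp
    moreover have "N a \<le> N (f t - a) + N (f t)" using tri[of "a - f t" "f t"] minus[of "f t - a"] by simp
    ultimately have "\<bar>N (f t) - N a\<bar> \<le> N (f t - a)" by linarith
    also have "\<dots> \<le> norm (f t - a) * (\<Sum>i\<in>UNIV. N (axis i 1))"
      using bound[of "f t - a"] by (simp only: mult.commute)
    finally show ?thesis by simp
  qed
  show ?thesis
    by (rule Lim_null[THEN iffD2], rule tendsto_0_le[OF Lim_null[THEN iffD1, OF lim], where K = "\<Sum>i\<in>UNIV. N (axis i 1)"])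
      (use lipschitz in auto)
qed

text \<open>
  The side condition excludes the nonzero constant vectors, which span the kernel of
  \<open>transpose (incidence C)\<close>. So \<open>v \<mapsto> (transpose (incidence C) *v v, 1 \<bullet> (diag g *v v))\<close> is
  injective, and an injective linear map in finite dimension is bounded below.
\<close>

lemma poincare_inequality:
  assumes graph: "indexed_graph C" "Digraph_Component.connected C" and g_pos: "\<And>i. g $ i > 0"
  obtains \<mu> where "\<mu> > 0"
    and "\<And>v. 1 \<bullet> (diag g *v v) = 0 \<Longrightarrow> \<mu> * norm v \<le> norm (transpose (incidence C) *v v)"
proof -
  let ?P = "\<lambda>v. (transpose (incidence C) *v v, 1 \<bullet> (diag g *v v))"
  have lin: "linear ?P"
    by (rule linearI) (auto simp: matrix_vector_right_distrib matrix_vector_mult_scaleR inner_add_right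
        simp del: transpose_matrix_vector)
  have "inj ?P"
    unfolding linear_injective_0[OF lin]
  proof (intro allI impI)
    fix v assume v: "?P v = 0"
    then have "v $ i = v $ undefined" for i
      using transpose_incidence_kernel[OF graph] by (metis prod.inject zero_prod_def)
    then have "v = v $ undefined *\<^sub>R 1" by (simp add: vec_eq_iff)
    moreover have "v $ undefined * (\<Sum>i\<in>UNIV. g $ i) = 0"
    proof -
      have "(\<Sum>i\<in>UNIV. g $ i * v $ i) = 0" using v by (simp add: inner_vec_def zero_prod_def)
      then show ?thesis
        using \<open>\<And>i. v $ i = v $ undefined\<close> by (metis (no_types, lifting) mult.commute sum.cong sum_distrib_left)
    qed
    moreover have "(\<Sum>i\<in>UNIV. g $ i) > 0" using g_pos by (intro sum_pos) auto
    ultimately show "v = 0" by (metis less_irrefl mult_eq_0_iff scaleR_zero_left)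
  qed
  then obtain \<mu> where "\<mu> > 0" "\<And>v. \<mu> * norm v \<le> norm (?P v)"
    using linear_inj_bounded_below_pos[OF lin] by blast
  then show ?thesis
    using that[of \<mu>] by (metis norm_Pair norm_zero power_zero_numeral add.right_neutral real_sqrt_abs abs_norm_cancel real_norm_def)
qed

lemma laplacian_const:
  assumes "indexed_graph C"
  shows "laplacian C *v (c *\<^sub>R 1) = 0"
  unfolding laplacian_def matrix_vector_mul_assoc[symmetric] transpose_incidence_const[OF assms] by simp

text \<open>
  Under the side condition the term with the multiplier \<open>c\<close> drops out, as it does in every
  constrained minimisation problem. Positivity of the right-hand side gives uniqueness below, and its
  size gives the estimate of the solution.
\<close>

lemma equilibrium_energy:
  fixes C :: "('n::finite, 'c::finite) pre_digraph" and g v :: "real ^ 'n"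
  assumes "1 \<bullet> (diag g *v v) = 0"
  shows "v \<bullet> (\<kappa> *\<^sub>R (laplacian C *v v) + diag g *v (diag g *v v) + c *\<^sub>R (diag g *v 1))
    = \<kappa> * (norm (transpose (incidence C) *v v))\<^sup>2 + (norm (diag g *v v))\<^sup>2"
  unfolding inner_add_right inner_scaleR_right inner_laplacian diag_self_adjoint[of g v, symmetric]
    power2_norm_eq_inner
  using assms by (simp add: inner_commute[of "diag g *v v" 1])

text \<open>
  The unknowns are the offset \<open>v\<close> and the multiplier \<open>c\<close>. The equations are a square linear system,
  so it is enough that the homogeneous system has only the zero solution.
\<close>

lemma equilibrium_exists:
  fixes C :: "('n::finite, 'c::finite) pre_digraph" and g h :: "real ^ 'n"
  assumes "\<And>i. g $ i > 0" "\<kappa> > 0"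
  obtains v c where "1 \<bullet> (diag g *v v) = 0"
    and "\<kappa> *\<^sub>R (laplacian C *v v) + diag g *v (diag g *v v) + c *\<^sub>R (diag g *v 1) = h"
proof -
  define T where "T = (\<lambda>(v, c). (\<kappa> *\<^sub>R (laplacian C *v v) + diag g *v (diag g *v v) + c *\<^sub>R (diag g *v 1),
      1 \<bullet> (diag g *v v)))"
  have lin: "linear T"
    unfolding T_def
    by (rule linearI) (auto simp: matrix_vector_right_distrib matrix_vector_mult_scaleR inner_add_right algebra_simps)
  have "inj T"
    unfolding linear_injective_0[OF lin]
  proof (intro allI impI)
    fix a assume "T a = 0"
    moreover obtain v c where a: "a = (v, c)" by (cases a)
    ultimately have eq: "\<kappa> *\<^sub>R (laplacian C *v v) + diag g *v (diag g *v v) + c *\<^sub>R (diag g *v 1) = 0"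
      and orth: "1 \<bullet> (diag g *v v) = 0"
      by (auto simp: T_def zero_prod_def)
    then have "\<kappa> * (norm (transpose (incidence C) *v v))\<^sup>2 + (norm (diag g *v v))\<^sup>2 = 0"
      using equilibrium_energy[OF orth, of \<kappa> C c] eq by simp
    moreover have "0 \<le> \<kappa> * (norm (transpose (incidence C) *v v))\<^sup>2" using assms(2) by simp
    ultimately have "(norm (diag g *v v))\<^sup>2 = 0" using zero_le_power2[of "norm (diag g *v v)"] by linarith
    then have "diag g *v v = 0" by simp
    then have "g $ i * v $ i = 0" for i by (metis diag_mult_nth zero_index)
    then have v: "v = 0" using assms(1) by (metis less_irrefl mult_eq_0_iff vec_eq_iff zero_index)
    with eq have "c *\<^sub>R (diag g *v 1) = 0" by simp
    then have "c * g $ undefined = 0"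
      by (metis diag_mult_nth mult.right_neutral one_index vector_scaleR_component zero_index real_scaleR_def)
    then have "c = 0" using assms(1) by (metis less_irrefl mult_eq_0_iff)
    with v a show "a = 0" by (simp add: zero_prod_def)
  qed
  then have "surj T" using linear_injective_imp_surjective[OF lin] by simp
  then obtain a where "T a = (h, 0)" by (metis surjD)
  then show ?thesis using that by (cases a) (auto simp: T_def)
qed

text \<open>
  The energy bounds \<open>\<kappa>\<close> times the squared disagreement of \<open>v\<close> by a constant, and the Poincare
  inequality bounds \<open>v\<close> by its disagreement. A large ratio \<open>\<kappa>\<close> of consensus gain to damping gain thus
  forces \<open>v\<close> to be small.
\<close>

lemma small_equilibrium_offset:
  fixes C :: "('n::finite, 'c::finite) pre_digraph" and g b :: "real ^ 'n"
  assumes graph: "indexed_graph C" "Digraph_Component.connected C"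
    and g_pos: "\<And>i. g $ i > 0" and "\<rho> > 0"
  obtains \<kappa> v c where "\<kappa> > 0" "norm v < \<rho>" "1 \<bullet> (diag g *v v) = 0"
    and "\<kappa> *\<^sub>R (laplacian C *v v) + diag g *v (diag g *v v) + c *\<^sub>R (diag g *v 1) = - (diag g *v b)"
proof -
  obtain \<mu> where "\<mu> > 0"
    and \<mu>: "\<And>v. 1 \<bullet> (diag g *v v) = 0 \<Longrightarrow> \<mu> * norm v \<le> norm (transpose (incidence C) *v v)"
    using poincare_inequality[OF graph g_pos] by blast
  define \<kappa> where "\<kappa> = (norm b / (\<mu> * \<rho>))\<^sup>2 + 1"
  have "\<kappa> > 0" by (simp add: \<kappa>_def add_nonneg_pos)
  obtain v c where orth: "1 \<bullet> (diag g *v v) = 0"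
    and eq: "\<kappa> *\<^sub>R (laplacian C *v v) + diag g *v (diag g *v v) + c *\<^sub>R (diag g *v 1) = - (diag g *v b)"
    using equilibrium_exists[where g = g and \<kappa> = \<kappa> and C = C and h = "- (diag g *v b)"] g_pos \<open>\<kappa> > 0\<close> by blast
  define n where "n = norm (diag g *v v)"
  have "\<kappa> * (norm (transpose (incidence C) *v v))\<^sup>2 + n\<^sup>2 = - ((diag g *v v) \<bullet> b)"
    using equilibrium_energy[OF orth, of \<kappa> C c] unfolding eq n_def by (simp add: diag_self_adjoint)
  also have "\<dots> \<le> n * norm b"
    using Cauchy_Schwarz_ineq2[of "diag g *v v" b] by (simp add: n_def)
  also have "\<dots> \<le> n\<^sup>2 + (norm b)\<^sup>2"
  proof -
    have "0 \<le> n * norm b" by (simp add: n_def)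
    then show ?thesis using sum_squares_bound[of n "norm b"] by linarith
  qed
  finally have le: "\<kappa> * (norm (transpose (incidence C) *v v))\<^sup>2 \<le> (norm b)\<^sup>2" by simp
  have "norm v < \<rho>"
  proof (rule ccontr)
    assume "\<not> norm v < \<rho>"
    then have "\<mu> * \<rho> \<le> norm (transpose (incidence C) *v v)"
      using \<mu>[OF orth] \<open>\<mu> > 0\<close> by (metis mult_le_cancel_left_pos not_less order_trans)
    then have "(\<mu> * \<rho>)\<^sup>2 \<le> (norm (transpose (incidence C) *v v))\<^sup>2"
      using \<open>\<mu> > 0\<close> \<open>\<rho> > 0\<close> by (intro power_mono) auto
    then have "\<kappa> * (\<mu> * \<rho>)\<^sup>2 \<le> (norm b)\<^sup>2"
      using le \<open>\<kappa> > 0\<close> by (meson mult_left_mono less_imp_le order_trans)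
    moreover have "\<kappa> * (\<mu> * \<rho>)\<^sup>2 = (norm b)\<^sup>2 + (\<mu> * \<rho>)\<^sup>2"
      using \<open>\<mu> > 0\<close> \<open>\<rho> > 0\<close> by (simp add: \<kappa>_def power_divide distrib_right)
    ultimately show False using \<open>\<mu> > 0\<close> \<open>\<rho> > 0\<close> by simp
  qed
  then show ?thesis using that \<open>\<kappa> > 0\<close> orth eq by blast
qed

lemma clip_affine:
  assumes "q > 0"
  shows "clip (q * lo + r) (q * hi + r) x = q * clip lo hi ((x - r) / q) + r"
  using assms by (simp add: clip_def max_def min_def field_simps)

text \<open>
  In terms of the multiplier \<open>lam\<close> of the budget constraint, the ideal node input is the one for
  which \<open>q\<^sub>i u\<^sub>i + r\<^sub>i\<close> equals \<open>lam\<close> at every node, and the feasible edge flow carries away the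
  imbalance that this input leaves.
\<close>

lemma feasibility_closed_forms:
  fixes q r d xs :: "real ^ 'n"
  assumes "\<forall>i. q $ i > 0"
  defines "g \<equiv> \<chi> i. 1 / q $ i"
  defines "E \<equiv> d - xs - diag g *v r"
  defines "lam \<equiv> - (1 \<bullet> E) / (1 \<bullet> (diag g *v 1))"
  shows "u_p_bar (diag q) r d xs = diag g *v (lam *\<^sub>R 1 - r)"
    and "(mat 1 - (1 / (1 \<bullet> (matrix_inv (diag q) *v 1))) *\<^sub>R (matrix_inv (diag q) ** ones_matrix)) *v
               (d - xs - matrix_inv (diag q) *v r) = E + lam *\<^sub>R (diag g *v 1)"
proof -
  have inv: "matrix_inv (diag q) = diag g" using matrix_inv_diag[OF assms(1)] by (simp add: g_def)
  have ones: "ones_matrix *v v = (1 \<bullet> v) *\<^sub>R (1 :: real ^ 'n)" for v :: "real ^ 'n"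
    by (simp add: vec_eq_iff ones_matrix_def matrix_vector_mult_def inner_vec_def)
  show "u_p_bar (diag q) r d xs = diag g *v (lam *\<^sub>R 1 - r)"
    unfolding u_p_bar_def inv E_def[symmetric]
    by (simp add: vec_eq_iff scaleR_matrix_vector_assoc[symmetric] ones lam_def right_diff_distrib distrib_left)
  show "(mat 1 - (1 / (1 \<bullet> (matrix_inv (diag q) *v 1))) *\<^sub>R (matrix_inv (diag q) ** ones_matrix)) *v
               (d - xs - matrix_inv (diag q) *v r) = E + lam *\<^sub>R (diag g *v 1)"
    unfolding inv E_def[symmetric]
    by (simp add: matrix_vector_mult_diff_rdistrib scaleR_matrix_vector_assoc[symmetric] ones lam_def
        matrix_vector_mul_assoc[symmetric] matrix_vector_mult_scaleR)
qed

text \<open>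
  Linearity of the choice makes a small change of the demand cause a small change of the flow.
\<close>

lemma incidence_right_inverse:
  assumes "indexed_graph G" "Digraph_Component.connected G"
  obtains R where "linear R" "\<And>u. 1 \<bullet> u = 0 \<Longrightarrow> incidence G *v R u = u"
proof -
  obtain R where R: "linear R" "\<forall>u\<in>range ((*v) (incidence G)). incidence G *v R u = u"
    using real_vector.linear_exists_right_inverse_on[OF matrix_vector_mul_linear[of "incidence G"] subspace_UNIV]
    by blast
  then show ?thesis using that range_incidence[OF assms] by blast
qed

lemma eventually_near_interior:
  fixes f :: "real ^ 'n \<Rightarrow> real ^ 'k"
  assumes "linear f" "vec_less lo c" "vec_less c hi"
  shows "\<forall>\<^sub>F v in nhds 0. vec_less lo (c + f v) \<and> vec_less (c + f v) hi"
proof -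
  have lim: "((\<lambda>v. (c + f v) $ i) \<longlongrightarrow> c $ i) (nhds 0)" for i
  proof -
    have "isCont f 0" using assms(1) by (simp add: linear_continuous_at linear_conv_bounded_linear)
    then have "(f \<longlongrightarrow> 0) (nhds 0)"
      using linear_0[OF assms(1)] by (metis continuous_at filterlim_at_within_not_equal tendsto_at_iff_tendsto_nhds)
    from tendsto_add[OF tendsto_const[of c] this] have "((\<lambda>v. c + f v) \<longlongrightarrow> c) (nhds 0)" by simp
    then show ?thesis by (rule tendsto_vec_nth)
  qed
  show ?thesis
    unfolding vec_less_def
    by (intro eventually_conj eventually_all_finite order_tendstoD[OF lim])
      (use assms in \<open>auto simp: vec_less_def\<close>)
qed

section \<open>Practical convergence of the closed loop\<close>

theorem theorem2:
  fixes G :: "('n::finite, 'm::finite) pre_digraph"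
    and C :: "('n, 'c::finite) pre_digraph"
    and N :: "real ^ 'n \<Rightarrow> real"
    and q r d xbar0 xbars up_min up_max :: "real ^ 'n"
    and ue_max :: "real ^ 'm"
    and \<epsilon>1 \<epsilon>2 :: real
  defines "B \<equiv> incidence G"
    and "Q \<equiv> diag q"
    and "Lc \<equiv> laplacian C"
    and "xbar \<equiv> (\<lambda>t::real. xbar0 + t *\<^sub>R xbars)"
  assumes "is_norm N"
    and "indexed_graph G"
    and "indexed_graph C" and "Digraph_Component.connected C"
    and "\<forall>i. q $ i > 0"
    and "feasible B Q r d xbars ue_max up_min up_max"
    and "\<exists>i j. q $ i \<noteq> q $ j"
    and "strongly_connected G"
    and "\<epsilon>1 > 0" and "\<epsilon>2 > 0"
  shows "\<exists>\<gamma>e>0. \<exists>\<gamma>c>0. \<exists>\<gamma>p>0. \<exists>\<gamma>l>0.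
    \<forall>x xe xp y ue up.
      closed_loop B Lc Q r d xbar ue_max up_min up_max \<gamma>e \<gamma>c \<gamma>p \<gamma>l x xe xp y ue up \<longrightarrow>
        (\<exists>l. ((\<lambda>t. N (x t - xbar t)) \<longlongrightarrow> l) at_top \<and> l < \<epsilon>1) \<and>
        (\<exists>l. ((\<lambda>t. N (up t - u_p_bar Q r d xbars)) \<longlongrightarrow> l) at_top \<and> l < \<epsilon>2) \<and>
        (\<forall>t\<ge>0. up_min \<le> up t \<and> up t \<le> up_max \<and> 0 \<le> ue t \<and> ue t \<le> ue_max)"
proof -
  note q_pos = \<open>\<forall>i. q $ i > 0\<close>
  have G_conn: "Digraph_Component.connected G"
    using assms(6,12) by (rule strongly_connected_imp_connected)
  define g where "g = (\<chi> i. 1 / q $ i)"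
  have g_pos: "g $ i > 0" for i using q_pos by (simp add: g_def)
  have inv: "matrix_inv Q = diag g" using matrix_inv_diag[OF q_pos] by (simp add: g_def Q_def)
  \<comment> \<open>\<open>b\<close> is the imbalance at the nodes under the ideal input \<open>upb\<close>\<close>
  define E where "E = d - xbars - diag g *v r"
  define lam where "lam = - (1 \<bullet> E) / (1 \<bullet> (diag g *v 1))"
  define b where "b = E + lam *\<^sub>R (diag g *v 1)"
  define upb where "upb = u_p_bar Q r d xbars"
  have upb: "upb = diag g *v (lam *\<^sub>R 1 - r)"
    using feasibility_closed_forms(1)[OF q_pos] by (simp add: upb_def Q_def lam_def E_def g_def)
  have feas_up: "vec_less up_min upb" "vec_less upb up_max"
    using assms(10) by (auto simp: feasible_def upb_def)
  obtain ueb where ueb: "B *v ueb = - b" "vec_less 0 ueb" "vec_less ueb ue_max"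
    using assms(10) feasibility_closed_forms(2)[OF q_pos, of d xbars r]
    unfolding feasible_def b_def lam_def E_def g_def Q_def by metis
  obtain R where R: "linear R" "\<And>u. 1 \<bullet> u = 0 \<Longrightarrow> B *v R u = u"
    using incidence_right_inverse[OF assms(6) G_conn] unfolding B_def by blast
  \<comment> \<open>the edge flow that balances the node input \<open>upb + diag g *v v\<close>\<close>
  define ueq where "ueq v = ueb + R (- (diag g *v v))" for v
  have "\<forall>\<^sub>F v in nhds 0. vec_less up_min (upb + diag g *v v) \<and> vec_less (upb + diag g *v v) up_max"
    by (rule eventually_near_interior[OF matrix_vector_mul_linear feas_up])
  moreover have "\<forall>\<^sub>F v in nhds 0. vec_less 0 (ueq v) \<and> vec_less (ueq v) ue_max"
    unfolding ueq_def
    by (rule eventually_near_interior[OF _ ueb(2,3)])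
      (intro linear_compose[unfolded o_def, OF _ R(1)] linear_compose_neg matrix_vector_mul_linear)
  moreover have "\<forall>\<^sub>F v in nhds 0. N (diag g *v v) < \<epsilon>2"
  proof -
    have "((*v) (diag g) \<longlongrightarrow> diag g *v 0) (nhds 0)"
      by (intro bounded_linear.tendsto[OF matrix_vector_mul_bounded_linear]) (rule filterlim_ident)
    moreover have "N (diag g *v 0) = 0" using assms(5) by (simp add: is_norm_def)
    ultimately show ?thesis
      using order_tendstoD(2)[OF is_norm_tendsto[OF assms(5)], of "(*v) (diag g)"] assms(14) by simp
  qed
  ultimately have "\<forall>\<^sub>F v in nhds 0. vec_less up_min (upb + diag g *v v) \<and> vec_less (upb + diag g *v v) up_max
      \<and> vec_less 0 (ueq v) \<and> vec_less (ueq v) ue_max \<and> N (diag g *v v) < \<epsilon>2"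
    by eventually_elim blast
  then obtain \<rho> where "\<rho> > 0" and \<rho>: "\<And>v. norm v < \<rho> \<Longrightarrow>
      vec_less up_min (upb + diag g *v v) \<and> vec_less (upb + diag g *v v) up_max
      \<and> vec_less 0 (ueq v) \<and> vec_less (ueq v) ue_max \<and> N (diag g *v v) < \<epsilon>2"
    unfolding eventually_nhds_metric by (auto simp: dist_norm)
  obtain \<kappa> v c where "\<kappa> > 0" and v: "norm v < \<rho>" "1 \<bullet> (diag g *v v) = 0"
    and eq: "\<kappa> *\<^sub>R (Lc *v v) + diag g *v (diag g *v v) + c *\<^sub>R (diag g *v 1) = - (diag g *v b)"
    using small_equilibrium_offset[OF assms(7,8) g_pos \<open>\<rho> > 0\<close>] unfolding Lc_def by blast
  have B_ueq: "B *v ueq v = - b - diag g *v v"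
    using R(2)[of "- (diag g *v v)"] v(2) ueb(1) by (simp add: ueq_def matrix_vector_right_distrib)
  have N1: "N (c *\<^sub>R 1) \<ge> 0"
    using is_norm_nonneg[OF assms(5)] .
  \<comment> \<open>The equilibrium output error is \<open>\<gamma>c * c\<close> at every node, where \<open>c\<close> depends only on the ratio
    \<open>\<kappa> = \<gamma>l / \<gamma>c\<close>; so \<open>\<gamma>c\<close> can be chosen after \<open>\<kappa>\<close>.\<close>
  define \<gamma>c where "\<gamma>c = \<epsilon>1 / (N (c *\<^sub>R 1) + 1)"
  have \<gamma>c: "\<gamma>c > 0" "\<gamma>c * N (c *\<^sub>R 1) < \<epsilon>1"
    using N1 assms(13) by (auto simp: \<gamma>c_def field_simps)
  define \<gamma>l where "\<gamma>l = \<gamma>c * \<kappa>"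
  have "\<gamma>l > 0" using \<gamma>c \<open>\<kappa> > 0\<close> by (simp add: \<gamma>l_def)
  \<comment> \<open>saturation limits and equilibrium value of the controller state\<close>
  define plo where "plo = Q *v up_min + r"
  define phi where "phi = Q *v up_max + r"
  define pc where "pc = lam *\<^sub>R 1 + v"
  have bounds: "up_min $ i < up_max $ i" "0 < ue_max $ k" for i k
    using feas_up ueb(2,3) unfolding vec_less_def by (force intro: less_trans)+
  have plo_less_phi: "plo $ i < phi $ i" for i
    using bounds q_pos by (simp add: plo_def phi_def Q_def)
  have up_pc: "upb + diag g *v v = diag g *v (pc - r)"
    by (simp add: upb pc_def vec_eq_iff algebra_simps)
  have pc_int: "plo $ i < pc $ i" "pc $ i < phi $ i" for i
  proof -
    have "up_min $ i < g $ i * (pc $ i - r $ i)" "g $ i * (pc $ i - r $ i) < up_max $ i"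
      using \<rho>[OF v(1)] unfolding up_pc vec_less_def by auto
    then show "plo $ i < pc $ i" "pc $ i < phi $ i"
      using q_pos by (auto simp: plo_def phi_def Q_def g_def field_simps)
  qed
  have main: "(\<exists>l. ((\<lambda>t. N (x t - xbar t)) \<longlongrightarrow> l) at_top \<and> l < \<epsilon>1) \<and>
        (\<exists>l. ((\<lambda>t. N (up t - u_p_bar Q r d xbars)) \<longlongrightarrow> l) at_top \<and> l < \<epsilon>2) \<and>
        (\<forall>t\<ge>0. up_min \<le> up t \<and> up t \<le> up_max \<and> 0 \<le> ue t \<and> ue t \<le> ue_max)"
    if cl: "closed_loop B Lc Q r d xbar ue_max up_min up_max 1 \<gamma>c 1 \<gamma>l x xe xp y ue up"
    for x xe xp y ue up
  proof -
    define ye where "ye t = x t - xbar t - (\<gamma>c * c) *\<^sub>R 1" for t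
    define s where "s t = sat (xp t) plo phi - pc" for t
    define z where "z t = - (\<gamma>c *\<^sub>R (transpose B *v ye t)) - xe t" for t
    define w where "w t = sat (z t) 0 ue_max - ueq v" for t
    have y_eq: "y t = ye t + (\<gamma>c * c) *\<^sub>R 1" if "t \<ge> 0" for t
      using cl that by (simp add: closed_loop_def ye_def)
    have BTy: "transpose B *v y t = transpose B *v ye t" if "t \<ge> 0" for t
      unfolding y_eq[OF that] matrix_vector_right_distrib B_def transpose_incidence_const[OF assms(6)] by simp
    have ue_eq: "ue t = w t + ueq v" "ue t = sat (z t) 0 ue_max" if "t \<ge> 0" for t
      using cl that BTy[OF that] by (auto simp: closed_loop_def w_def z_def simp del: transpose_matrix_vector)
    have up_eq: "up t = diag g *v (s t + pc - r)" if "t \<ge> 0" for t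
    proof -
      have "sat (diag g *v (xp t - r)) up_min up_max $ i = g $ i * ((sat (xp t) plo phi) $ i - r $ i)" for i
        using clip_affine[of "q $ i" "up_min $ i" "r $ i" "up_max $ i" "xp t $ i"] q_pos
        by (simp add: sat_nth less_imp_le bounds plo_less_phi)
          (simp add: plo_def phi_def Q_def g_def less_imp_neq[symmetric])
      then have "sat (diag g *v (xp t - r)) up_min up_max = diag g *v (s t + pc - r)"
        by (simp add: vec_eq_iff s_def)
      then show ?thesis using cl that by (simp add: closed_loop_def inv)
    qed
    have ye_deriv: "(ye has_vector_derivative (B *v w t + diag g *v s t)) (at t within {0..})" if "t \<ge> 0" for t
    proof -
      have "(x has_vector_derivative (B *v ue t + up t + d)) (at t within {0..})"
        using cl that unfolding closed_loop_def by blast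
      moreover have "(xbar has_vector_derivative xbars) (at t within {0..})"
        unfolding xbar_def by (auto intro!: derivative_eq_intros)
      ultimately have "(ye has_vector_derivative (B *v ue t + up t + d - xbars)) (at t within {0..})"
        unfolding ye_def[abs_def] by (auto intro!: derivative_eq_intros)
      moreover have "B *v ue t + up t + d - xbars = B *v w t + diag g *v s t"
        unfolding ue_eq(1)[OF that] up_eq[OF that] matrix_vector_right_distrib B_ueq
        by (simp add: pc_def b_def E_def vec_eq_iff algebra_simps)
      ultimately show ?thesis by simp
    qed
    have xp_deriv: "(xp has_vector_derivative
        (- (\<gamma>l *\<^sub>R (laplacian C *v s t)) - diag g *v (ye t - \<gamma>c *\<^sub>R (B *v w t)))) (at t within {0..})"
      if "t \<ge> 0" for t
    proof -
      have "(xp has_vector_derivative (- (\<gamma>l *\<^sub>R (Lc *v (s t + pc))) - diag g *v (y t - \<gamma>c *\<^sub>R (B *v ue t))))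
          (at t within {0..})"
      proof -
        have "(xp has_vector_derivative (- (\<gamma>l *\<^sub>R (Lc *v sat (xp t) ((1 / 1) *\<^sub>R (Q *v up_min + r))
              ((1 / 1) *\<^sub>R (Q *v up_max + r)))) - 1 *\<^sub>R (matrix_inv Q *v (y t - \<gamma>c *\<^sub>R (B *v ue t)))))
            (at t within {0..})"
          using cl that unfolding closed_loop_def by blast
        then show ?thesis by (simp add: inv s_def plo_def phi_def)
      qed
      moreover have "- (\<gamma>l *\<^sub>R (Lc *v (s t + pc))) - diag g *v (y t - \<gamma>c *\<^sub>R (B *v ue t))
          = - (\<gamma>l *\<^sub>R (Lc *v s t)) - diag g *v (ye t - \<gamma>c *\<^sub>R (B *v w t))
            - \<gamma>c *\<^sub>R (\<kappa> *\<^sub>R (Lc *v v) + diag g *v (diag g *v v) + c *\<^sub>R (diag g *v 1) + diag g *v b)"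
      proof -
        have "Lc *v pc = Lc *v v"
          by (simp add: pc_def matrix_vector_right_distrib Lc_def laplacian_const[OF assms(7)])
        then show ?thesis
          unfolding y_eq[OF that] ue_eq(1)[OF that] matrix_vector_right_distrib B_ueq \<gamma>l_def
          by (simp add: vec_eq_iff algebra_simps)
      qed
      ultimately show ?thesis using eq by (simp add: Lc_def)
    qed
    have z_deriv: "(z has_vector_derivative
        (- (\<gamma>c *\<^sub>R (transpose B *v (B *v w t + diag g *v s t))) - transpose B *v ye t)) (at t within {0..})"
      if "t \<ge> 0" for t
    proof -
      have "(xe has_vector_derivative (transpose B *v ye t)) (at t within {0..})"
      proof -
        have "(xe has_vector_derivative (1 *\<^sub>R (transpose B *v y t))) (at t within {0..})"
          using cl that unfolding closed_loop_def by blast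
        then show ?thesis unfolding BTy[OF that] by (simp del: transpose_matrix_vector)
      qed
      then show ?thesis
        unfolding z_def[abs_def]
        by (intro has_vector_derivative_diff has_vector_derivative_minus
            bounded_linear.has_vector_derivative[OF bounded_linear_scaleR_right]
            bounded_linear.has_vector_derivative[OF matrix_vector_mul_bounded_linear] ye_deriv that)
    qed
    have "vec_less 0 (ueq v)" "vec_less (ueq v) ue_max" using \<rho>[OF v(1)] by auto
    then have ueq_adm: "0 $ k \<le> ueq v $ k" "ueq v $ k \<le> ue_max $ k" for k
      by (auto simp: vec_less_def less_imp_le)
    interpret saturated_error_system B C g \<gamma>c \<gamma>l plo phi pc 0 ue_max "ueq v" ye xp s z w
      by unfold_locales
        (use assms(7,8) g_pos \<gamma>c \<open>\<gamma>l > 0\<close> pc_int ueq_adm ye_deriv xp_deriv z_deriv in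
          \<open>simp_all add: s_def w_def sat_nth bounds less_imp_le plo_less_phi\<close>)
    obtain i j where "g $ i \<noteq> g $ j"
      using assms(11) q_pos by (auto simp: g_def)
    note lims = errors_vanish[OF this]
    have "((\<lambda>t. x t - xbar t) \<longlongrightarrow> 0 + (\<gamma>c * c) *\<^sub>R 1) at_top"
      using tendsto_add[OF lims(1) tendsto_const[of "(\<gamma>c * c) *\<^sub>R 1"]] by (simp add: ye_def)
    then have "((\<lambda>t. N (x t - xbar t)) \<longlongrightarrow> N (\<gamma>c *\<^sub>R (c *\<^sub>R 1))) at_top"
      using is_norm_tendsto[OF assms(5)] by fastforce
    moreover have "N (\<gamma>c *\<^sub>R (c *\<^sub>R 1)) < \<epsilon>1"
    proof -
      have "N (\<gamma>c *\<^sub>R (c *\<^sub>R 1)) = \<bar>\<gamma>c\<bar> * N (c *\<^sub>R 1)"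
        using assms(5) unfolding is_norm_def by blast
      then show ?thesis using \<gamma>c by simp
    qed
    moreover have "((\<lambda>t. N (up t - upb)) \<longlongrightarrow> N (diag g *v v)) at_top"
    proof (rule is_norm_tendsto[OF assms(5)])
      have "((\<lambda>t. diag g *v s t + diag g *v v) \<longlongrightarrow> diag g *v 0 + diag g *v v) at_top"
        by (intro tendsto_intros bounded_linear.tendsto[OF matrix_vector_mul_bounded_linear] lims)
      moreover have "\<forall>\<^sub>F t in at_top. diag g *v s t + diag g *v v = up t - upb"
        using eventually_ge_at_top[of 0]
      proof eventually_elim
        case (elim t)
        have "up t = diag g *v s t + (upb + diag g *v v)"
          unfolding up_eq[OF elim] up_pc by (simp add: vec_eq_iff algebra_simps)
        then show ?case by simp
      qed
      ultimately show "((\<lambda>t. up t - upb) \<longlongrightarrow> diag g *v v) at_top"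
        by (simp add: tendsto_cong)
    qed
    moreover have "N (diag g *v v) < \<epsilon>2" using \<rho>[OF v(1)] by blast
    moreover have "up_min \<le> up t \<and> up t \<le> up_max \<and> 0 \<le> ue t \<and> ue t \<le> ue_max" if "t \<ge> 0" for t
    proof -
      have "up t = sat (matrix_inv Q *v (1 *\<^sub>R xp t - r)) up_min up_max"
        using cl that by (simp add: closed_loop_def)
      then show ?thesis
        using ue_eq(2)[OF that] bounds
        by (simp add: less_eq_vec_def sat_nth less_imp_le clip_bounds)
    qed
    ultimately show ?thesis unfolding upb_def by blast
  qed
  show ?thesis
    by (rule exI[of _ 1], rule conjI, simp, rule exI[of _ \<gamma>c], rule conjI, rule \<gamma>c(1),
        rule exI[of _ 1], rule conjI, simp, rule exI[of _ \<gamma>l], rule conjI, rule \<open>\<gamma>l > 0\<close>)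
      (use main in blast)
qed

end
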